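(* Let $M=\mathbb{T}^3$ with Haar probability measure $\mu$, let $u\in C^1(M;\mathbb{R}^3)$ be an autonomous divergence-free vector field, and let $\Phi=\Phi_1$ be the time-$1$ map of its flow. Let $U$ be the Koopman unitary $Uf=f\circ\Phi^{-1}$ on $L^2(M,\mu)$, let $M_f$ denote multiplication by $f\in L^\infty(M)$ on $L^2(M,\mu)$, and let $\mathcal{M}_u:=L^\infty(M)\rtimes_\alpha\mathbb{Z}=W^*(L^\infty(M),U)$ with its canonical trace $\tau_u$. Let $F=\{f_1,\dots,f_m\}\subset L^\infty(M)$ and define the positive element $$A_F:=\mathbf{1}+\sum_{j=1}^m [U,M_{f_j}]^*[U,M_{f_j}]\in\mathcal{M}_u,\qquad \mathcal{S}(F):=\tau_u(\log A_F).$$ Then $A_F$ belongs to $L^\infty(M)\subset\mathcal{M}_u$ and is given by $$A_F=M_{1+h_F},\qquad h_F(x):=\sum_{j=1}^m|f_j(x)-f_j(\Phi x)|^2\in L^\infty(M).$$ Consequently, $$\mathcal{S}(F)=\int_M\log\big(1+h_F(x)\big)\,d\mu(x)\in[0,\infty).$$ Moreover, $\mathcal{S}(F)=0$ if and only if $f_j\circ\Phi=f_j$ $\mu$-a.e. for all $j$.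
   Context: The flow $\Phi_t$ of $u$ is defined by $\frac{d}{dt}\Phi_t(x)=u(\Phi_t(x))$, $\Phi_0=\mathrm{id}$; since $\nabla\cdot u=0$, each $\Phi_t$ preserves $\mu$. The Koopman unitary group on $L^2(M,\mu)$ is $(U_tf)(x)=f(\Phi_{-t}(x))$, and $U:=U_1$. The action $\alpha:\mathbb{Z}\to\mathrm{Aut}(L^\infty(M))$ is $\alpha_n(f)=f\circ\Phi^{-n}$, with $\alpha(f)=\alpha_1(f)$. The algebra $L^\infty(M)$ acts on $L^2(M,\mu)$ by the multiplication operators $M_f$. The crossed-product von Neumann algebra is defined as $\mathcal{M}_u:=L^\infty(M)\rtimes_\alpha\mathbb{Z}=W^*(L^\infty(M),U)$, i.e. the von Neumann algebra generated by $L^\infty(M)$ and $U$ subject to the covariance relation $UM_fU^{-1}=M_{\alpha(f)}$ for $f\in L^\infty(M)$; its elements are taken to admit Fourier-type expansions $\sum_{n\in\mathbb{Z}}M_{f_n}U^n$ in a suitable topology. It is taken to carry the canonical faithful normal conditional expectation $E:\mathcal{M}_u\to L^\infty(M)$ given on finite sums by $E\big(\sum_n M_{f_n}U^n\big)=M_{f_0}$, and $\tau_u(x):=\int_M E(x)\,d\mu$ is taken as its canonical faithful normal tracial state. Here $[a,b]=ab-ba$, $\mathbf{1}$ is the identity, and $\log A_F$ is defined by functional calculus. *)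

theory Defs
  imports "HOL-Analysis.Analysis" "HOL-Computational_Algebra.Polynomial"
begin

section \<open>The torus, its Haar measure, and flows of vector fields\<close>

quotient_type torus3 = "real^3" / "\<lambda>x y. \<forall>i. x $ i - y $ i \<in> \<int>"
proof (rule equivpI)
  show "reflp (\<lambda>x y :: real^3. \<forall>i. x $ i - y $ i \<in> \<int>)"
    by (auto simp: reflp_def)
  show "symp (\<lambda>x y :: real^3. \<forall>i. x $ i - y $ i \<in> \<int>)"
    unfolding symp_def by (metis Ints_minus minus_diff_eq)
  show "transp (\<lambda>x y :: real^3. \<forall>i. x $ i - y $ i \<in> \<int>)"
    unfolding transp_def
  proof (intro allI impI)
    fix x y z :: "real^3" and i
    assume "\<forall>i. x $ i - y $ i \<in> \<int>" "\<forall>i. y $ i - z $ i \<in> \<int>"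
    then have "(x $ i - y $ i) + (y $ i - z $ i) \<in> \<int>"
      by (intro Ints_add) auto
    then show "x $ i - z $ i \<in> \<int>" by simp
  qed
qed

abbreviation torus_proj :: "real^3 \<Rightarrow> torus3"
  where "torus_proj \<equiv> abs_torus3"

instantiation torus3 :: topological_space
begin

definition open_torus3 :: "torus3 set \<Rightarrow> bool"
  where "open_torus3 S \<longleftrightarrow> open (torus_proj -` S)"

instance
  by standard (auto simp: open_torus3_def vimage_Union)

end

lemma continuous_on_torus_proj: "continuous_on UNIV torus_proj"
  by (auto simp: continuous_on_open_vimage open_torus3_def)

definition unit_cell :: "(real^3) set"
  where "unit_cell = {x. \<forall>i. 0 \<le> x $ i \<and> x $ i < 1}"

text \<open>The Haar probability measure is the image of Lebesgue measure on a fundamental domain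
  of the lattice of integer vectors.\<close>

definition haar :: "torus3 measure"
  where "haar = distr (restrict_space lborel unit_cell) borel torus_proj"

lemma sets_haar [measurable_cong, simp]: "sets haar = sets borel"
  by (simp add: haar_def)

lemma space_haar [simp]: "space haar = UNIV"
  by (simp add: haar_def)

lemma torus_proj_measurable: "torus_proj \<in> borel_measurable borel"
  by (intro borel_measurable_continuous_onI continuous_on_torus_proj)

lemma emeasure_haar_UNIV: "emeasure haar UNIV = 1"
proof -
  have meas: "unit_cell \<in> sets lborel"
    unfolding unit_cell_def by measurable
  have "box 0 (\<chi> i. 1) \<subseteq> unit_cell" "unit_cell \<subseteq> cbox 0 (\<chi> i. 1)"
    by (auto simp: unit_cell_def mem_box_cart less_imp_le)
  then have "emeasure lborel (box 0 (\<chi> i. 1) :: (real^3) set) \<le> emeasure lborel unit_cell"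
    and "emeasure lborel unit_cell \<le> emeasure lborel (cbox 0 (\<chi> i. 1) :: (real^3) set)"
    using meas by (auto intro!: emeasure_mono)
  moreover have "(\<Prod>b\<in>Basis. ((\<chi> i. 1) - 0 :: real^3) \<bullet> b) = 1"
    by (intro prod.neutral) (auto simp: Basis_vec_def inner_axis)
  moreover have "\<forall>b\<in>Basis. (0 :: real^3) \<bullet> b \<le> (\<chi> i. 1) \<bullet> b"
    by (auto simp: Basis_vec_def inner_axis)
  ultimately have "emeasure lborel unit_cell = 1"
    by (simp add: emeasure_lborel_cbox_eq emeasure_lborel_box_eq)
  then show ?thesis
    unfolding haar_def using meas
    by (subst emeasure_distr)
       (auto simp: emeasure_restrict_space space_restrict_space
             intro!: measurable_restrict_space1 torus_proj_measurable)
qed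

text \<open>Vector fields on the torus have three global components; differentiability is read off
  from the periodic lift to \<open>real^3\<close>.\<close>

definition C1_field :: "(torus3 \<Rightarrow> real^3) \<Rightarrow> bool"
  where "C1_field u \<longleftrightarrow>
    (\<exists>D :: real^3 \<Rightarrow> ((real^3) \<Rightarrow>\<^sub>L (real^3)).
       (\<forall>x. ((\<lambda>y. u (torus_proj y)) has_derivative blinfun_apply (D x)) (at x)) \<and>
       continuous_on UNIV D)"

definition divergence :: "(torus3 \<Rightarrow> real^3) \<Rightarrow> real^3 \<Rightarrow> real"
  where "divergence u x =
    (\<Sum>i\<in>UNIV. frechet_derivative (\<lambda>y. u (torus_proj y)) (at x) (axis i 1) $ i)"

definition divergence_free :: "(torus3 \<Rightarrow> real^3) \<Rightarrow> bool"
  where "divergence_free u \<longleftrightarrow> (\<forall>x. divergence u x = 0)"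

text \<open>A curve in the torus solves the differential equation if it is covered by a curve in
  \<open>real^3\<close> that does.\<close>

definition is_flow :: "(torus3 \<Rightarrow> real^3) \<Rightarrow> (real \<Rightarrow> torus3 \<Rightarrow> torus3) \<Rightarrow> bool"
  where "is_flow u \<Phi> \<longleftrightarrow>
    \<Phi> 0 = id \<and>
    (\<forall>x. \<exists>c :: real \<Rightarrow> real^3. \<forall>t.
       torus_proj (c t) = \<Phi> t x \<and> (c has_vector_derivative u (\<Phi> t x)) (at t))"


section \<open>Complex inner product spaces and bounded operators\<close>

text \<open>The complex inner product is antilinear in its first argument. The norm and the topology
  are those of the underlying real inner product space, so bounded operators are the complex-linear
  elements of the type of bounded real-linear maps.\<close>

class complex_inner = real_inner +
  fixes scaleC :: "complex \<Rightarrow> 'a \<Rightarrow> 'a"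
    and cinner :: "'a \<Rightarrow> 'a \<Rightarrow> complex"
  assumes scaleC_add_right: "scaleC a (x + y) = scaleC a x + scaleC a y"
    and scaleC_add_left: "scaleC (a + b) x = scaleC a x + scaleC b x"
    and scaleC_scaleC: "scaleC a (scaleC b x) = scaleC (a * b) x"
    and scaleC_of_real: "scaleC (complex_of_real r) x = scaleR r x"
    and cinner_commute: "cinner x y = cnj (cinner y x)"
    and cinner_add_left: "cinner (x + y) z = cinner x z + cinner y z"
    and cinner_scaleC_left: "cinner (scaleC a x) y = cnj a * cinner x y"
    and inner_eq_Re_cinner: "inner x y = Re (cinner x y)"

definition bounded_ops :: "('h::complex_inner \<Rightarrow>\<^sub>L 'h) set"
  where "bounded_ops = {A. \<forall>a x. blinfun_apply A (scaleC a x) = scaleC a (blinfun_apply A x)}"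

definition adj :: "('h::complex_inner \<Rightarrow>\<^sub>L 'h) \<Rightarrow> ('h \<Rightarrow>\<^sub>L 'h)"
  where "adj A = (THE B. \<forall>x y. cinner (blinfun_apply B x) y = cinner x (blinfun_apply A y))"

definition positive_op :: "('h::complex_inner \<Rightarrow>\<^sub>L 'h) \<Rightarrow> bool"
  where "positive_op A \<longleftrightarrow> A \<in> bounded_ops \<and>
    (\<forall>x. Im (cinner x (blinfun_apply A x)) = 0 \<and> Re (cinner x (blinfun_apply A x)) \<ge> 0)"

definition commutator :: "('h::complex_inner \<Rightarrow>\<^sub>L 'h) \<Rightarrow> ('h \<Rightarrow>\<^sub>L 'h) \<Rightarrow> ('h \<Rightarrow>\<^sub>L 'h)"
  where "commutator A B = (A o\<^sub>L B) - (B o\<^sub>L A)"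

definition commutant :: "('h::complex_inner \<Rightarrow>\<^sub>L 'h) set \<Rightarrow> ('h \<Rightarrow>\<^sub>L 'h) set"
  where "commutant S = {B \<in> bounded_ops. \<forall>A\<in>S. B o\<^sub>L A = A o\<^sub>L B}"

definition vN_generated :: "('h::complex_inner \<Rightarrow>\<^sub>L 'h) set \<Rightarrow> ('h \<Rightarrow>\<^sub>L 'h) set"
  where "vN_generated S = commutant (commutant (S \<union> adj ` S))"

lemma subset_vN_generated: "S \<subseteq> bounded_ops \<Longrightarrow> S \<subseteq> vN_generated S"
  by (auto simp: vN_generated_def commutant_def)

definition scaleC_op :: "complex \<Rightarrow> 'h::complex_inner \<Rightarrow>\<^sub>L 'h"
  where "scaleC_op a = Blinfun (scaleC a)"

definition spectrum :: "('h::complex_inner \<Rightarrow>\<^sub>L 'h) \<Rightarrow> complex set"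
  where "spectrum A = {z. \<not> (\<exists>B\<in>bounded_ops.
    B o\<^sub>L (A - scaleC_op z) = id_blinfun \<and> (A - scaleC_op z) o\<^sub>L B = id_blinfun)}"

primrec op_power :: "('h::complex_inner \<Rightarrow>\<^sub>L 'h) \<Rightarrow> nat \<Rightarrow> ('h \<Rightarrow>\<^sub>L 'h)"
  where
    "op_power A 0 = id_blinfun"
  | "op_power A (Suc n) = A o\<^sub>L op_power A n"

definition op_poly :: "real poly \<Rightarrow> ('h::complex_inner \<Rightarrow>\<^sub>L 'h) \<Rightarrow> ('h \<Rightarrow>\<^sub>L 'h)"
  where "op_poly p A = (\<Sum>i\<le>degree p. coeff p i *\<^sub>R op_power A i)"

text \<open>Continuous functional calculus of a self-adjoint operator, whose spectrum is real:
  \<open>g(A)\<close> is the norm limit of \<open>p\<^sub>n(A)\<close> for polynomials \<open>p\<^sub>n\<close> converging to \<open>g\<close> uniformly on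
  the spectrum.\<close>

definition fun_calc :: "(real \<Rightarrow> real) \<Rightarrow> ('h::complex_inner \<Rightarrow>\<^sub>L 'h) \<Rightarrow> ('h \<Rightarrow>\<^sub>L 'h)"
  where "fun_calc g A = (THE B. \<forall>p :: nat \<Rightarrow> real poly.
    uniform_limit {r. complex_of_real r \<in> spectrum A} (\<lambda>n. poly (p n)) g sequentially \<longrightarrow>
    (\<lambda>n. op_poly (p n) A) \<longlonglongrightarrow> B)"


section \<open>Square-integrable functions on the torus\<close>

definition sq_integrable :: "(torus3 \<Rightarrow> complex) \<Rightarrow> bool"
  where "sq_integrable f \<longleftrightarrow>
    f \<in> borel_measurable haar \<and> integrable haar (\<lambda>x. (cmod (f x))\<^sup>2)"

lemma measurable_cnj [measurable]:
  "f \<in> borel_measurable M \<Longrightarrow> (\<lambda>x. cnj (f x)) \<in> borel_measurable M"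
  by (rule borel_measurable_continuous_on[of cnj]) (auto intro: continuous_intros)

lemma sq_integrable_add:
  assumes "sq_integrable f" "sq_integrable g"
  shows "sq_integrable (\<lambda>x. f x + g x)"
proof -
  have [measurable]: "f \<in> borel_measurable haar" "g \<in> borel_measurable haar"
    using assms by (auto simp: sq_integrable_def)
  have "integrable haar (\<lambda>x. (cmod (f x + g x))\<^sup>2)"
  proof (rule Bochner_Integration.integrable_bound)
    show "integrable haar (\<lambda>x. 2 * (cmod (f x))\<^sup>2 + 2 * (cmod (g x))\<^sup>2)"
      using assms by (auto simp: sq_integrable_def)
    have "(cmod (a + b))\<^sup>2 \<le> 2 * (cmod a)\<^sup>2 + 2 * (cmod b)\<^sup>2" for a b :: complex
    proof -
      have "(cmod (a + b))\<^sup>2 \<le> (cmod a + cmod b)\<^sup>2"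
        by (intro power_mono norm_triangle_ineq) auto
      also have "\<dots> \<le> 2 * (cmod a)\<^sup>2 + 2 * (cmod b)\<^sup>2"
        using sum_squares_bound[of "cmod a" "cmod b"] by (simp add: power2_sum)
      finally show ?thesis .
    qed
    then show "AE x in haar. norm ((cmod (f x + g x))\<^sup>2)
        \<le> norm (2 * (cmod (f x))\<^sup>2 + 2 * (cmod (g x))\<^sup>2)"
      by auto
  qed measurable
  then show ?thesis by (simp add: sq_integrable_def)
qed

lemma sq_integrable_cmult:
  assumes "sq_integrable f"
  shows "sq_integrable (\<lambda>x. a * f x)"
  using assms by (auto simp: sq_integrable_def norm_mult power_mult_distrib)

lemma integrable_cnj_mult:
  assumes "sq_integrable f" "sq_integrable g"
  shows "integrable haar (\<lambda>x. cnj (f x) * g x)"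
proof (rule Bochner_Integration.integrable_bound)
  have [measurable]: "f \<in> borel_measurable haar" "g \<in> borel_measurable haar"
    using assms by (auto simp: sq_integrable_def)
  show "integrable haar (\<lambda>x. (cmod (f x))\<^sup>2 + (cmod (g x))\<^sup>2)"
    using assms by (auto simp: sq_integrable_def)
  have "cmod a * cmod b \<le> (cmod a)\<^sup>2 + (cmod b)\<^sup>2" for a b
    using sum_squares_bound[of "cmod a" "cmod b"] mult_nonneg_nonneg[of "cmod a" "cmod b"]
    by (simp del: mult_nonneg_nonneg)
  then show "AE x in haar. norm (cnj (f x) * g x) \<le> norm ((cmod (f x))\<^sup>2 + (cmod (g x))\<^sup>2)"
    by (auto simp: norm_mult)
  show "(\<lambda>x. cnj (f x) * g x) \<in> borel_measurable haar"
    by measurable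
qed

quotient_type L2 = "torus3 \<Rightarrow> complex" /
  partial: "\<lambda>f g. sq_integrable f \<and> sq_integrable g \<and> (AE x in haar. f x = g x)"
proof (rule part_equivpI)
  have "sq_integrable (\<lambda>x. 0)" by (simp add: sq_integrable_def)
  then show "\<exists>f. sq_integrable f \<and> sq_integrable f \<and> (AE x in haar. f x = f x)"
    by auto
  show "symp (\<lambda>f g. sq_integrable f \<and> sq_integrable g \<and> (AE x in haar. f x = g x))"
    by (auto simp: symp_def eq_commute)
  show "transp (\<lambda>f g. sq_integrable f \<and> sq_integrable g \<and> (AE x in haar. f x = g x))"
    unfolding transp_def by (auto elim: AE_mp)
qed

instantiation L2 :: complex_inner
begin

lift_definition zero_L2 :: L2 is "\<lambda>x. 0"
  by (simp add: sq_integrable_def)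

lift_definition plus_L2 :: "L2 \<Rightarrow> L2 \<Rightarrow> L2" is "\<lambda>f g x. f x + g x"
  by (auto intro: sq_integrable_add elim: AE_mp)

lift_definition scaleC_L2 :: "complex \<Rightarrow> L2 \<Rightarrow> L2" is "\<lambda>a f x. a * f x"
  by (auto intro: sq_integrable_cmult elim: AE_mp)

lift_definition cinner_L2 :: "L2 \<Rightarrow> L2 \<Rightarrow> complex"
  is "\<lambda>f g. \<integral>x. cnj (f x) * g x \<partial>haar"
  by (rule integral_cong_AE)
     (auto simp: sq_integrable_def intro!: borel_measurable_times elim: AE_mp)

definition scaleR_L2 :: "real \<Rightarrow> L2 \<Rightarrow> L2"
  where "scaleR_L2 r f = scaleC (complex_of_real r) f"

definition uminus_L2 :: "L2 \<Rightarrow> L2"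
  where "uminus_L2 f = scaleC (-1) f"

definition minus_L2 :: "L2 \<Rightarrow> L2 \<Rightarrow> L2"
  where "minus_L2 f g = f + - g"

definition inner_L2 :: "L2 \<Rightarrow> L2 \<Rightarrow> real"
  where "inner_L2 f g = Re (cinner f g)"

definition norm_L2 :: "L2 \<Rightarrow> real"
  where "norm_L2 f = sqrt (inner f f)"

definition sgn_L2 :: "L2 \<Rightarrow> L2"
  where "sgn_L2 f = scaleR (inverse (norm f)) f"

definition dist_L2 :: "L2 \<Rightarrow> L2 \<Rightarrow> real"
  where "dist_L2 f g = norm (f - g)"

definition uniformity_L2 :: "(L2 \<times> L2) filter"
  where "uniformity_L2 = (INF e\<in>{0 <..}. principal {(f, g). dist f g < e})"

definition open_L2 :: "L2 set \<Rightarrow> bool"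
  where "open_L2 S = (\<forall>f\<in>S. \<forall>\<^sub>F (f', g) in uniformity. f' = f \<longrightarrow> g \<in> S)"

instance
proof
  fix f g h :: L2 and a b :: complex and r r' :: real
  show add_assoc: "f + g + h = f + (g + h)" for f g h :: L2
    by transfer (auto intro: sq_integrable_add simp: add.assoc)
  show add_commute: "f + g = g + f" for f g :: L2
    by transfer (auto intro: sq_integrable_add simp: add.commute)
  show add_0: "0 + f = f" for f :: L2
    by transfer auto
  show "- f + f = 0"
    unfolding uminus_L2_def by transfer (auto simp: sq_integrable_def)
  show "f - g = f + - g"
    by (simp add: minus_L2_def)
  show sC_right: "scaleC a (f + g) = scaleC a f + scaleC a g" for a and f g :: L2
    by transfer (auto intro!: sq_integrable_add sq_integrable_cmult simp: distrib_left)
  show sC_left: "scaleC (a + b) f = scaleC a f + scaleC b f" for a b and f :: L2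
    by transfer (auto intro!: sq_integrable_add sq_integrable_cmult simp: distrib_right)
  show sC_sC: "scaleC a (scaleC b f) = scaleC (a * b) f" for a b and f :: L2
    by transfer (auto intro!: sq_integrable_cmult simp: mult.assoc)
  show "scaleC (complex_of_real r) f = r *\<^sub>R f"
    by (simp add: scaleR_L2_def)
  show "r *\<^sub>R (f + g) = r *\<^sub>R f + r *\<^sub>R g"
    by (simp add: scaleR_L2_def sC_right)
  show "(r + r') *\<^sub>R f = r *\<^sub>R f + r' *\<^sub>R f"
    by (simp add: scaleR_L2_def sC_left)
  show "r *\<^sub>R r' *\<^sub>R f = (r * r') *\<^sub>R f"
    by (simp add: scaleR_L2_def sC_sC)
  show "1 *\<^sub>R f = f"
    unfolding scaleR_L2_def by transfer auto
  show cinner_commute: "cinner f g = cnj (cinner g f)" for f g :: L2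
    by transfer (subst Bochner_Integration.integral_cnj[symmetric], simp add: mult.commute)
  show cinner_add: "cinner (f + g) h = cinner f h + cinner g h" for f g h :: L2
    by transfer (simp add: distrib_right integrable_cnj_mult)
  show cinner_sC: "cinner (scaleC a f) g = cnj a * cinner f g" for a and f g :: L2
    by transfer (simp add: mult.assoc)
  show "inner f g = Re (cinner f g)"
    by (simp add: inner_L2_def)
  show "inner f g = inner g f"
    using cinner_commute[of f g] by (simp add: inner_L2_def)
  show "inner (f + g) h = inner f h + inner g h"
    by (simp add: inner_L2_def cinner_add)
  show "inner (r *\<^sub>R f) g = r * inner f g"
    by (simp add: inner_L2_def scaleR_L2_def cinner_sC)
  have cinner_self: "Re (cinner f f) \<ge> 0 \<and> (Re (cinner f f) = 0 \<longleftrightarrow> f = 0)"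
  proof (transfer, goal_cases)
    case (1 f)
    then have int: "integrable haar (\<lambda>x. (cmod (f x))\<^sup>2)"
      by (simp add: sq_integrable_def)
    have "(\<integral>x. cnj (f x) * f x \<partial>haar) = (\<integral>x. complex_of_real ((cmod (f x))\<^sup>2) \<partial>haar)"
      by (simp add: complex_norm_square mult.commute flip: of_real_power)
    then have "Re (\<integral>x. cnj (f x) * f x \<partial>haar) = (\<integral>x. (cmod (f x))\<^sup>2 \<partial>haar)"
      by (simp only: integral_complex_of_real Re_complex_of_real)
    then show ?case
      using 1 int by (simp add: integral_nonneg_eq_0_iff_AE sq_integrable_def)
  qed
  show "inner f f \<ge> 0" "inner f f = 0 \<longleftrightarrow> f = 0"
    using cinner_self by (auto simp: inner_L2_def)
qed (simp_all only: norm_L2_def sgn_L2_def dist_L2_def uniformity_L2_def open_L2_def)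

end

text \<open>Elements of \<open>L\<^sup>\<infinity>\<close> are represented by functions, to be identified when they agree almost
  everywhere.\<close>

definition Linf :: "(torus3 \<Rightarrow> complex) set"
  where "Linf = {f \<in> borel_measurable haar. \<exists>C. AE x in haar. cmod (f x) \<le> C}"

definition mult_op :: "(torus3 \<Rightarrow> complex) \<Rightarrow> (L2 \<Rightarrow>\<^sub>L L2)"
  where "mult_op f = Blinfun (\<lambda>g. abs_L2 (\<lambda>x. f x * rep_L2 g x))"

definition koopman :: "(torus3 \<Rightarrow> torus3) \<Rightarrow> (L2 \<Rightarrow>\<^sub>L L2)"
  where "koopman T = Blinfun (\<lambda>g. abs_L2 (\<lambda>x. rep_L2 g (inv T x)))"


section \<open>Square-summable sequences in a complex inner product space\<close>

typedef (overloaded) 'h ell2 =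
  "{\<xi> :: int \<Rightarrow> 'h::complex_inner. (\<lambda>n. (norm (\<xi> n))\<^sup>2) summable_on UNIV}"
  by (rule exI[of _ "\<lambda>n. 0"]) simp

setup_lifting type_definition_ell2

lemma norm_scaleC: "norm (scaleC a (x :: 'h::complex_inner)) = cmod a * norm x"
proof -
  have "(norm (scaleC a x))\<^sup>2 = Re (cnj a * (a * cinner x x))"
    unfolding power2_norm_eq_inner inner_eq_Re_cinner cinner_scaleC_left
    by (subst (1) cinner_commute) (simp add: cinner_scaleC_left flip: cinner_commute)
  also have "cnj a * (a * cinner x x) = complex_of_real ((cmod a)\<^sup>2) * cinner x x"
    by (simp add: complex_norm_square mult_ac flip: of_real_power)
  also have "Re \<dots> = (cmod a * norm x)\<^sup>2"
    by (simp add: power_mult_distrib power2_norm_eq_inner inner_eq_Re_cinner)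
  finally show ?thesis
    by (simp add: power2_eq_iff_nonneg)
qed

lemma cmod_cinner_le: "cmod (cinner x y) \<le> (norm x)\<^sup>2 + (norm (y :: 'h::complex_inner))\<^sup>2"
proof -
  have Re_le: "\<bar>Re (cinner x y)\<bar> \<le> norm x * norm y" for x y :: 'h
    using Cauchy_Schwarz_ineq2[of x y] by (simp add: inner_eq_Re_cinner)
  have "\<bar>Im (cinner x y)\<bar> = \<bar>Re (cinner (scaleC \<i> x) y)\<bar>"
    by (simp add: cinner_scaleC_left)
  also have "\<dots> \<le> norm x * norm y"
    using Re_le[of "scaleC \<i> x" y] by (simp add: norm_scaleC)
  finally have "cmod (cinner x y) \<le> 2 * norm x * norm y"
    using cmod_le[of "cinner x y"] Re_le[of x y] by linarith
  also have "\<dots> \<le> (norm x)\<^sup>2 + (norm y)\<^sup>2"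
    by (rule sum_squares_bound)
  finally show ?thesis .
qed

lemma summable_cinner:
  fixes \<xi> \<eta> :: "int \<Rightarrow> 'h::complex_inner"
  assumes "(\<lambda>n. (norm (\<xi> n))\<^sup>2) summable_on UNIV" "(\<lambda>n. (norm (\<eta> n))\<^sup>2) summable_on UNIV"
  shows "(\<lambda>n. cinner (\<xi> n) (\<eta> n)) summable_on UNIV"
proof (rule abs_summable_summable, rule summable_on_comparison_test)
  show "(\<lambda>n. (norm (\<xi> n))\<^sup>2 + (norm (\<eta> n))\<^sup>2) summable_on UNIV"
    using assms by (rule summable_on_add)
qed (auto intro: cmod_cinner_le)

lemma norm_add_square_le:
  "(norm (x + y :: 'h::real_inner))\<^sup>2 \<le> 2 * (norm x)\<^sup>2 + 2 * (norm y)\<^sup>2"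
proof -
  have "(norm (x + y))\<^sup>2 \<le> (norm x + norm y)\<^sup>2"
    by (intro power_mono norm_triangle_ineq) auto
  also have "\<dots> \<le> 2 * (norm x)\<^sup>2 + 2 * (norm y)\<^sup>2"
    using sum_squares_bound[of "norm x" "norm y"] by (simp add: power2_sum)
  finally show ?thesis .
qed

instantiation ell2 :: (complex_inner) complex_inner
begin

lift_definition zero_ell2 :: "'a ell2" is "\<lambda>n. 0"
  by simp

lift_definition plus_ell2 :: "'a ell2 \<Rightarrow> 'a ell2 \<Rightarrow> 'a ell2" is "\<lambda>\<xi> \<eta> n. \<xi> n + \<eta> n"
proof -
  fix \<xi> \<eta> :: "int \<Rightarrow> 'a"
  assume "(\<lambda>n. (norm (\<xi> n))\<^sup>2) summable_on UNIV" "(\<lambda>n. (norm (\<eta> n))\<^sup>2) summable_on UNIV"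
  then have "(\<lambda>n. 2 * (norm (\<xi> n))\<^sup>2 + 2 * (norm (\<eta> n))\<^sup>2) summable_on UNIV"
    by (intro summable_on_add summable_on_cmult_right)
  then show "(\<lambda>n. (norm (\<xi> n + \<eta> n))\<^sup>2) summable_on UNIV"
    by (rule summable_on_comparison_test) (auto intro: norm_add_square_le)
qed

lift_definition scaleC_ell2 :: "complex \<Rightarrow> 'a ell2 \<Rightarrow> 'a ell2" is "\<lambda>a \<xi> n. scaleC a (\<xi> n)"
  by (simp add: norm_scaleC power_mult_distrib summable_on_cmult_right)

lift_definition cinner_ell2 :: "'a ell2 \<Rightarrow> 'a ell2 \<Rightarrow> complex"
  is "\<lambda>\<xi> \<eta>. \<Sum>\<^sub>\<infinity>n. cinner (\<xi> n) (\<eta> n)" .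

definition scaleR_ell2 :: "real \<Rightarrow> 'a ell2 \<Rightarrow> 'a ell2"
  where "scaleR_ell2 r \<xi> = scaleC (complex_of_real r) \<xi>"

definition uminus_ell2 :: "'a ell2 \<Rightarrow> 'a ell2"
  where "uminus_ell2 \<xi> = scaleC (-1) \<xi>"

definition minus_ell2 :: "'a ell2 \<Rightarrow> 'a ell2 \<Rightarrow> 'a ell2"
  where "minus_ell2 \<xi> \<eta> = \<xi> + - \<eta>"

definition inner_ell2 :: "'a ell2 \<Rightarrow> 'a ell2 \<Rightarrow> real"
  where "inner_ell2 \<xi> \<eta> = Re (cinner \<xi> \<eta>)"

definition norm_ell2 :: "'a ell2 \<Rightarrow> real"
  where "norm_ell2 \<xi> = sqrt (inner \<xi> \<xi>)"

definition sgn_ell2 :: "'a ell2 \<Rightarrow> 'a ell2"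
  where "sgn_ell2 \<xi> = scaleR (inverse (norm \<xi>)) \<xi>"

definition dist_ell2 :: "'a ell2 \<Rightarrow> 'a ell2 \<Rightarrow> real"
  where "dist_ell2 \<xi> \<eta> = norm (\<xi> - \<eta>)"

definition uniformity_ell2 :: "('a ell2 \<times> 'a ell2) filter"
  where "uniformity_ell2 = (INF e\<in>{0 <..}. principal {(\<xi>, \<eta>). dist \<xi> \<eta> < e})"

definition open_ell2 :: "'a ell2 set \<Rightarrow> bool"
  where "open_ell2 S = (\<forall>\<xi>\<in>S. \<forall>\<^sub>F (\<xi>', \<eta>) in uniformity. \<xi>' = \<xi> \<longrightarrow> \<eta> \<in> S)"

instance
proof
  fix \<xi> \<eta> \<zeta> :: "'a ell2" and a b :: complex and r r' :: real
  have scaleC_one: "scaleC 1 x = x" for x :: 'a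
    using scaleC_of_real[of 1 x] by simp
  have scaleC_zero: "scaleC 0 x = 0" for x :: 'a
    using scaleC_of_real[of 0 x] by simp
  show "\<xi> + \<eta> + \<zeta> = \<xi> + (\<eta> + \<zeta>)"
    by transfer (simp add: add.assoc)
  show "\<xi> + \<eta> = \<eta> + \<xi>"
    by transfer (simp add: add.commute)
  show "0 + \<xi> = \<xi>"
    by transfer simp
  have "scaleC (-1) x + x = 0" for x :: 'a
    using scaleC_add_left[of "-1" 1 x] by (simp add: scaleC_one scaleC_zero)
  then show "- \<xi> + \<xi> = 0"
    unfolding uminus_ell2_def by transfer simp
  show "\<xi> - \<eta> = \<xi> + - \<eta>"
    by (simp add: minus_ell2_def)
  show sC_right: "scaleC a (\<xi> + \<eta>) = scaleC a \<xi> + scaleC a \<eta>" for a and \<xi> \<eta> :: "'a ell2"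
    by transfer (simp add: scaleC_add_right)
  show sC_left: "scaleC (a + b) \<xi> = scaleC a \<xi> + scaleC b \<xi>" for a b and \<xi> :: "'a ell2"
    by transfer (simp add: scaleC_add_left)
  show sC_sC: "scaleC a (scaleC b \<xi>) = scaleC (a * b) \<xi>" for a b and \<xi> :: "'a ell2"
    by transfer (simp add: scaleC_scaleC)
  show "scaleC (complex_of_real r) \<xi> = r *\<^sub>R \<xi>"
    by (simp add: scaleR_ell2_def)
  show "r *\<^sub>R (\<xi> + \<eta>) = r *\<^sub>R \<xi> + r *\<^sub>R \<eta>"
    by (simp add: scaleR_ell2_def sC_right)
  show "(r + r') *\<^sub>R \<xi> = r *\<^sub>R \<xi> + r' *\<^sub>R \<xi>"
    by (simp add: scaleR_ell2_def sC_left)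
  show "r *\<^sub>R r' *\<^sub>R \<xi> = (r * r') *\<^sub>R \<xi>"
    by (simp add: scaleR_ell2_def sC_sC)
  show "1 *\<^sub>R \<xi> = \<xi>"
    unfolding scaleR_ell2_def by transfer (simp add: scaleC_one)
  show cinner_commute: "cinner \<xi> \<eta> = cnj (cinner \<eta> \<xi>)" for \<xi> \<eta> :: "'a ell2"
    by transfer (simp flip: infsum_cnj cinner_commute)
  show cinner_add: "cinner (\<xi> + \<eta>) \<zeta> = cinner \<xi> \<zeta> + cinner \<eta> \<zeta>" for \<xi> \<eta> \<zeta> :: "'a ell2"
    by transfer (simp add: cinner_add_left infsum_add summable_cinner)
  show cinner_sC: "cinner (scaleC a \<xi>) \<eta> = cnj a * cinner \<xi> \<eta>" for a and \<xi> \<eta> :: "'a ell2"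
    by transfer (simp add: cinner_scaleC_left infsum_cmult_right')
  show "inner \<xi> \<eta> = Re (cinner \<xi> \<eta>)"
    by (simp add: inner_ell2_def)
  show "inner \<xi> \<eta> = inner \<eta> \<xi>"
    using cinner_commute[of \<xi> \<eta>] by (simp add: inner_ell2_def)
  show "inner (\<xi> + \<eta>) \<zeta> = inner \<xi> \<zeta> + inner \<eta> \<zeta>"
    by (simp add: inner_ell2_def cinner_add)
  show "inner (r *\<^sub>R \<xi>) \<eta> = r * inner \<xi> \<eta>"
    by (simp add: inner_ell2_def scaleR_ell2_def cinner_sC)
  have cinner_self: "Re (cinner \<xi> \<xi>) \<ge> 0 \<and> (Re (cinner \<xi> \<xi>) = 0 \<longleftrightarrow> \<xi> = 0)"
  proof (transfer, goal_cases)
    case (1 \<xi>)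
    have "Re (\<Sum>\<^sub>\<infinity>n. cinner (\<xi> n) (\<xi> n)) = (\<Sum>\<^sub>\<infinity>n. (norm (\<xi> n))\<^sup>2)"
      using summable_cinner[OF 1 1]
      by (simp add: power2_norm_eq_inner inner_eq_Re_cinner flip: infsum_Re)
    moreover have "(\<Sum>\<^sub>\<infinity>n. (norm (\<xi> n))\<^sup>2) \<ge> 0"
      by (intro infsum_nonneg) auto
    moreover have "\<xi> n = 0" if "(\<Sum>\<^sub>\<infinity>n. (norm (\<xi> n))\<^sup>2) = 0" for n
      using nonneg_infsum_le_0D[of "\<lambda>n. (norm (\<xi> n))\<^sup>2" UNIV n] that 1 by simp
    ultimately show ?case
      by (auto simp: fun_eq_iff)
  qed
  show "inner \<xi> \<xi> \<ge> 0" "inner \<xi> \<xi> = 0 \<longleftrightarrow> \<xi> = 0"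
    using cinner_self by (auto simp: inner_ell2_def)
qed (simp_all only: norm_ell2_def sgn_ell2_def dist_ell2_def uniformity_ell2_def open_ell2_def)

end


section \<open>The crossed product\<close>

text \<open>Since the action is implemented by the Koopman unitary \<open>U\<close>, the crossed product is the von
  Neumann algebra on \<open>\<ell>\<^sup>2(\<int>, L\<^sup>2) = \<ell>\<^sup>2(\<int>) \<otimes> L\<^sup>2\<close> generated by the operators \<open>1 \<otimes> M\<^sub>f\<close>, the copy of
  \<open>L\<^sup>\<infinity>\<close>, and the unitary \<open>\<lambda> \<otimes> U\<close>, where \<open>\<lambda>\<close> is the bilateral shift. The untensored operators
  \<open>M\<^sub>f\<close> and \<open>U\<close> on \<open>L\<^sup>2\<close> satisfy the same covariance relation, but the von Neumann algebra they
  generate there need not have a conditional expectation onto \<open>L\<^sup>\<infinity>\<close> or a tracial state (it is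
  the algebra of all bounded operators when the action is ergodic).\<close>

definition amplify :: "('h::complex_inner \<Rightarrow>\<^sub>L 'h) \<Rightarrow> ('h ell2 \<Rightarrow>\<^sub>L 'h ell2)"
  where "amplify A = Blinfun (\<lambda>\<xi>. Abs_ell2 (\<lambda>n. blinfun_apply A (Rep_ell2 \<xi> n)))"

definition shift_amplify :: "('h::complex_inner \<Rightarrow>\<^sub>L 'h) \<Rightarrow> ('h ell2 \<Rightarrow>\<^sub>L 'h ell2)"
  where "shift_amplify A = Blinfun (\<lambda>\<xi>. Abs_ell2 (\<lambda>n. blinfun_apply A (Rep_ell2 \<xi> (n - 1))))"

definition cp_mult :: "(torus3 \<Rightarrow> complex) \<Rightarrow> (L2 ell2 \<Rightarrow>\<^sub>L L2 ell2)"
  where "cp_mult f = amplify (mult_op f)"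

definition cp_unitary :: "(torus3 \<Rightarrow> torus3) \<Rightarrow> (L2 ell2 \<Rightarrow>\<^sub>L L2 ell2)"
  where "cp_unitary T = shift_amplify (koopman T)"

definition cp_Linf :: "(L2 ell2 \<Rightarrow>\<^sub>L L2 ell2) set"
  where "cp_Linf = cp_mult ` Linf"

definition crossed_product :: "(torus3 \<Rightarrow> torus3) \<Rightarrow> (L2 ell2 \<Rightarrow>\<^sub>L L2 ell2) set"
  where "crossed_product T = vN_generated (insert (cp_unitary T) cp_Linf)"

text \<open>In the matrix over \<open>\<int> \<times> \<int>\<close> of the operator \<open>M\<^sub>f U\<^sup>n\<close> of the crossed product, only the entries
  at \<open>(k, k - n)\<close> are nonzero, and they are \<open>M\<^sub>f U\<^sup>n\<close> on \<open>L\<^sup>2\<close>. So the entry at \<open>(0, 0)\<close> of a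
  finite sum \<open>\<Sum>\<^sub>n M\<^bsub>f\<^sub>n\<^esub> U\<^sup>n\<close> is the multiplication by \<open>f\<^sub>0\<close>, and taking this entry is the
  canonical conditional expectation onto \<open>L\<^sup>\<infinity>\<close>.\<close>

definition at_zero :: "'h::complex_inner \<Rightarrow> 'h ell2"
  where "at_zero g = Abs_ell2 (\<lambda>n. if n = 0 then g else 0)"

definition entry_00 :: "('h::complex_inner ell2 \<Rightarrow>\<^sub>L 'h ell2) \<Rightarrow> ('h \<Rightarrow>\<^sub>L 'h)"
  where "entry_00 X = Blinfun (\<lambda>g. Rep_ell2 (blinfun_apply X (at_zero g)) 0)"

definition cond_exp :: "(L2 ell2 \<Rightarrow>\<^sub>L L2 ell2) \<Rightarrow> (torus3 \<Rightarrow> complex)"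
  where "cond_exp X = (SOME f. f \<in> Linf \<and> mult_op f = entry_00 X)"

definition cp_trace :: "(L2 ell2 \<Rightarrow>\<^sub>L L2 ell2) \<Rightarrow> complex"
  where "cp_trace X = (\<integral>x. cond_exp X x \<partial>haar)"


section \<open>Action of the operators and of the conditional expectation\<close>

lemma sq_integrable_rep_L2: "sq_integrable (rep_L2 g)"
  using Quotient_rep_reflp[OF Quotient_L2] by blast

lemma abs_rep_L2: "abs_L2 (rep_L2 g) = g"
  by (rule Quotient_abs_rep[OF Quotient_L2])

lemma abs_L2_eq_iff:
  assumes "sq_integrable f" "sq_integrable g"
  shows "abs_L2 f = abs_L2 g \<longleftrightarrow> (AE x in haar. f x = g x)"
  using Quotient_rel[OF Quotient_L2, of f g] assms by auto

lemma rep_abs_L2: "sq_integrable f \<Longrightarrow> AE x in haar. rep_L2 (abs_L2 f) x = f x"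
  using Quotient_rep_abs[OF Quotient_L2, of f] by auto

lemma norm_abs_L2:
  assumes "sq_integrable f"
  shows "(norm (abs_L2 f))\<^sup>2 = (\<integral>x. (cmod (f x))\<^sup>2 \<partial>haar)"
proof -
  have "(norm (abs_L2 f))\<^sup>2 = Re (\<integral>x. cnj (f x) * f x \<partial>haar)"
    using assms by (simp add: power2_norm_eq_inner inner_L2_def cinner_L2.abs_eq)
  also have "(\<integral>x. cnj (f x) * f x \<partial>haar) = (\<integral>x. complex_of_real ((cmod (f x))\<^sup>2) \<partial>haar)"
    by (simp add: complex_norm_square mult.commute flip: of_real_power)
  finally show ?thesis
    by (simp only: integral_complex_of_real Re_complex_of_real)
qed

lemma sq_integrable_mult:
  assumes "f \<in> Linf" "sq_integrable g"
  shows "sq_integrable (\<lambda>x. f x * g x)"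
proof -
  obtain C where C: "AE x in haar. cmod (f x) \<le> C"
    using assms by (auto simp: Linf_def)
  have [measurable]: "f \<in> borel_measurable haar" "g \<in> borel_measurable haar"
    using assms by (auto simp: Linf_def sq_integrable_def)
  have "integrable haar (\<lambda>x. (cmod (f x * g x))\<^sup>2)"
  proof (rule Bochner_Integration.integrable_bound)
    show "integrable haar (\<lambda>x. C\<^sup>2 * (cmod (g x))\<^sup>2)"
      using assms by (auto simp: sq_integrable_def)
    show "AE x in haar. norm ((cmod (f x * g x))\<^sup>2) \<le> norm (C\<^sup>2 * (cmod (g x))\<^sup>2)"
      using C by eventually_elim (auto simp: norm_mult power_mult_distrib intro!: mult_right_mono power_mono)
  qed measurable
  then show ?thesis by (simp add: sq_integrable_def)
qed

lemma abs_L2_add: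
  assumes "sq_integrable f" "sq_integrable g"
  shows "abs_L2 f + abs_L2 g = abs_L2 (\<lambda>x. f x + g x)"
  using assms by (simp add: plus_L2.abs_eq)

lemma abs_L2_scaleR:
  assumes "sq_integrable f"
  shows "r *\<^sub>R abs_L2 f = abs_L2 (\<lambda>x. complex_of_real r * f x)"
  using assms by (simp add: scaleR_L2_def scaleC_L2.abs_eq)

lemma mult_op_apply:
  assumes "f \<in> Linf"
  shows "blinfun_apply (mult_op f) g = abs_L2 (\<lambda>x. f x * rep_L2 g x)"
proof -
  note sq = sq_integrable_mult[OF assms] sq_integrable_rep_L2 sq_integrable_add sq_integrable_cmult
  have rep_add: "AE x in haar. rep_L2 (g + h) x = rep_L2 g x + rep_L2 h x" for g h
    using rep_abs_L2[of "\<lambda>x. rep_L2 g x + rep_L2 h x"]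
    by (simp add: sq abs_rep_L2 flip: abs_L2_add)
  have rep_scale: "AE x in haar. rep_L2 (r *\<^sub>R g) x = complex_of_real r * rep_L2 g x" for r g
    using rep_abs_L2[of "\<lambda>x. complex_of_real r * rep_L2 g x"]
    by (simp add: sq abs_rep_L2 flip: abs_L2_scaleR)
  obtain C where C: "AE x in haar. cmod (f x) \<le> C"
    using assms by (auto simp: Linf_def)
  have "bounded_linear (\<lambda>g. abs_L2 (\<lambda>x. f x * rep_L2 g x))"
  proof (rule bounded_linear_intro[where K = "\<bar>C\<bar>"])
    fix g h :: L2 and r :: real
    show "abs_L2 (\<lambda>x. f x * rep_L2 (g + h) x)
        = abs_L2 (\<lambda>x. f x * rep_L2 g x) + abs_L2 (\<lambda>x. f x * rep_L2 h x)"
      using rep_add[of g h]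
      by (auto simp: abs_L2_add abs_L2_eq_iff sq distrib_left)
    show "abs_L2 (\<lambda>x. f x * rep_L2 (r *\<^sub>R g) x) = r *\<^sub>R abs_L2 (\<lambda>x. f x * rep_L2 g x)"
      using rep_scale[of r g]
      by (auto simp: abs_L2_scaleR abs_L2_eq_iff sq mult_ac)
    have "(norm (abs_L2 (\<lambda>x. f x * rep_L2 g x)))\<^sup>2 = (\<integral>x. (cmod (f x * rep_L2 g x))\<^sup>2 \<partial>haar)"
      by (simp add: norm_abs_L2 sq)
    also have "\<dots> \<le> (\<integral>x. C\<^sup>2 * (cmod (rep_L2 g x))\<^sup>2 \<partial>haar)"
    proof (rule integral_mono_AE)
      show "integrable haar (\<lambda>x. (cmod (f x * rep_L2 g x))\<^sup>2)"
        "integrable haar (\<lambda>x. C\<^sup>2 * (cmod (rep_L2 g x))\<^sup>2)"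
        using sq(1)[OF sq(2)] sq(2) unfolding sq_integrable_def by auto
      show "AE x in haar. (cmod (f x * rep_L2 g x))\<^sup>2 \<le> C\<^sup>2 * (cmod (rep_L2 g x))\<^sup>2"
        using C by eventually_elim
          (auto simp: norm_mult power_mult_distrib intro!: mult_right_mono power_mono)
    qed
    also have "\<dots> = (norm g * \<bar>C\<bar>)\<^sup>2"
      using norm_abs_L2[OF sq(2)[of g]] by (simp add: abs_rep_L2 power_mult_distrib mult.commute)
    finally show "norm (abs_L2 (\<lambda>x. f x * rep_L2 g x)) \<le> norm g * \<bar>C\<bar>"
      by (rule power2_le_imp_le) simp
  qed
  then show ?thesis
    by (simp add: mult_op_def bounded_linear_Blinfun_apply)
qed

lemma mult_op_eq_iff:
  assumes "f \<in> Linf" "g \<in> Linf"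
  shows "mult_op f = mult_op g \<longleftrightarrow> (AE x in haar. f x = g x)"
proof
  have one: "sq_integrable (\<lambda>x. 1)"
    using finite_measure.integrable_const[of haar "1 :: real"] finite_measureI[of haar]
    by (simp add: sq_integrable_def emeasure_haar_UNIV)
  note rep_one = rep_abs_L2[OF one]
  {
    assume "mult_op f = mult_op g"
    then have "abs_L2 (\<lambda>x. f x * rep_L2 (abs_L2 (\<lambda>x. 1)) x) =
        abs_L2 (\<lambda>x. g x * rep_L2 (abs_L2 (\<lambda>x. 1)) x)"
      using mult_op_apply[OF assms(1), of "abs_L2 (\<lambda>x. 1)"]
        mult_op_apply[OF assms(2), of "abs_L2 (\<lambda>x. 1)"] by simp
    then have "AE x in haar. f x * rep_L2 (abs_L2 (\<lambda>x. 1)) x = g x * rep_L2 (abs_L2 (\<lambda>x. 1)) x"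
      using assms by (subst (asm) abs_L2_eq_iff) (auto intro: sq_integrable_mult sq_integrable_rep_L2)
    with rep_one show "AE x in haar. f x = g x"
      by eventually_elim auto
  }
  assume eq: "AE x in haar. f x = g x"
  show "mult_op f = mult_op g"
    by (rule blinfun_eqI)
       (use eq in \<open>auto simp: mult_op_apply assms abs_L2_eq_iff sq_integrable_mult sq_integrable_rep_L2\<close>)
qed

lemma koopman_apply:
  assumes meas [measurable]: "inv T \<in> borel_measurable borel"
    and pres: "distr haar haar (inv T) = haar"
  shows "blinfun_apply (koopman T) g = abs_L2 (\<lambda>x. rep_L2 g (inv T x))"
    and "norm (blinfun_apply (koopman T) g) = norm g"
proof -
  have T [measurable]: "inv T \<in> measurable haar haar"
    using meas by (simp cong: measurable_cong_sets)
  have sq: "sq_integrable (\<lambda>x. g (inv T x))" if "sq_integrable g" for g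
    using that integrable_distr_eq[OF T, of "\<lambda>x. (cmod (g x))\<^sup>2"]
    by (auto simp: sq_integrable_def pres intro: measurable_compose[OF T])
  have AE: "AE x in haar. P (inv T x)" if "AE x in haar. P x" for P
  proof -
    have "AE x in distr haar haar (inv T). P x"
      using that by (simp only: pres)
    then show ?thesis by (rule AE_distrD[OF T])
  qed
  have sq_rep: "sq_integrable (\<lambda>x. rep_L2 g (inv T x))" for g
    by (rule sq) (rule sq_integrable_rep_L2)
  note sq' = sq_rep sq_integrable_rep_L2 sq_integrable_add sq_integrable_cmult
  have rep_add: "AE x in haar. rep_L2 (g + h) x = rep_L2 g x + rep_L2 h x" for g h
    using rep_abs_L2[of "\<lambda>x. rep_L2 g x + rep_L2 h x"]
    by (simp add: sq' abs_rep_L2 flip: abs_L2_add)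
  have rep_scale: "AE x in haar. rep_L2 (r *\<^sub>R g) x = complex_of_real r * rep_L2 g x" for r g
    using rep_abs_L2[of "\<lambda>x. complex_of_real r * rep_L2 g x"]
    by (simp add: sq' abs_rep_L2 flip: abs_L2_scaleR)
  have norm: "norm (abs_L2 (\<lambda>x. rep_L2 g (inv T x))) = norm g" for g
  proof -
    have "(norm (abs_L2 (\<lambda>x. rep_L2 g (inv T x))))\<^sup>2 = (\<integral>x. (cmod (rep_L2 g (inv T x)))\<^sup>2 \<partial>haar)"
      by (simp add: norm_abs_L2 sq')
    also have "\<dots> = (\<integral>x. (cmod (rep_L2 g x))\<^sup>2 \<partial>haar)"
      using sq_integrable_rep_L2[of g]
      by (subst (2) pres[symmetric], subst integral_distr[OF T]) (auto simp: sq_integrable_def)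
    also have "\<dots> = (norm g)\<^sup>2"
      using norm_abs_L2[OF sq_integrable_rep_L2[of g]] by (simp add: abs_rep_L2)
    finally show ?thesis
      by (simp add: power2_eq_iff_nonneg)
  qed
  have "bounded_linear (\<lambda>g. abs_L2 (\<lambda>x. rep_L2 g (inv T x)))"
    by (rule bounded_linear_intro[where K = 1])
       (use AE[OF rep_add] AE[OF rep_scale] in \<open>auto simp: abs_L2_add abs_L2_scaleR abs_L2_eq_iff sq' norm\<close>)
  then show "blinfun_apply (koopman T) g = abs_L2 (\<lambda>x. rep_L2 g (inv T x))"
    by (simp add: koopman_def bounded_linear_Blinfun_apply)
  then show "norm (blinfun_apply (koopman T) g) = norm g"
    by (simp add: norm)
qed

lemma norm_ell2: "(norm \<xi>)\<^sup>2 = (\<Sum>\<^sub>\<infinity>n. (norm (Rep_ell2 \<xi> n))\<^sup>2)"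
proof -
  have "(\<lambda>n. (norm (Rep_ell2 \<xi> n))\<^sup>2) summable_on UNIV"
    using Rep_ell2[of \<xi>] by simp
  note summable_cinner[OF this this]
  then show ?thesis
    by (simp add: power2_norm_eq_inner inner_eq_Re_cinner cinner_ell2.rep_eq flip: infsum_Re)
qed

lemma Rep_ell2_plus: "Rep_ell2 (\<xi> + \<eta>) n = Rep_ell2 \<xi> n + Rep_ell2 \<eta> n"
  by transfer simp

lemma Rep_ell2_zero: "Rep_ell2 0 n = 0"
  by transfer simp

lemma Rep_ell2_scaleR: "Rep_ell2 (r *\<^sub>R \<xi>) n = r *\<^sub>R Rep_ell2 \<xi> n"
  by (simp only: scaleR_ell2_def scaleC_ell2.rep_eq) (rule scaleC_of_real)

lemma Rep_ell2_shift_apply: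
  fixes A :: "'h::complex_inner \<Rightarrow>\<^sub>L 'h"
  assumes "bij s"
  defines "B \<equiv> (\<lambda>\<xi>. Abs_ell2 (\<lambda>n. blinfun_apply A (Rep_ell2 \<xi> (s n))))"
  shows "bounded_linear B" "Rep_ell2 (B \<xi>) n = blinfun_apply A (Rep_ell2 \<xi> (s n))"
proof -
  have s: "(\<lambda>n. (norm (Rep_ell2 \<xi> (s n)))\<^sup>2) summable_on UNIV" for \<xi> :: "'h ell2"
    using Rep_ell2[of \<xi>]
      summable_on_reindex_bij_betw[OF assms(1), of "\<lambda>n. (norm (Rep_ell2 \<xi> n))\<^sup>2"]
    by simp
  have le: "(norm (blinfun_apply A x))\<^sup>2 \<le> (norm A)\<^sup>2 * (norm x)\<^sup>2" for x
    using power_mono[OF norm_blinfun[of A x], of 2] by (simp add: power_mult_distrib)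
  have sum: "(\<lambda>n. (norm (blinfun_apply A (Rep_ell2 \<xi> (s n))))\<^sup>2) summable_on UNIV" for \<xi>
    by (rule summable_on_comparison_test[OF summable_on_cmult_right[OF s[of \<xi>], of "(norm A)\<^sup>2"]])
       (auto intro: le)
  show Rep: "Rep_ell2 (B \<xi>) n = blinfun_apply A (Rep_ell2 \<xi> (s n))" for \<xi> n
    unfolding B_def by (subst Abs_ell2_inverse) (use sum in auto)
  show "bounded_linear B"
  proof (rule bounded_linear_intro[where K = "norm A"])
    show "B (\<xi> + \<eta>) = B \<xi> + B \<eta>" for \<xi> \<eta>
      by (simp add: Rep Rep_ell2_plus blinfun.add_right fun_eq_iff flip: Rep_ell2_inject)
    show "B (r *\<^sub>R \<xi>) = r *\<^sub>R B \<xi>" for r \<xi>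
      by (simp add: Rep Rep_ell2_scaleR blinfun.scaleR_right fun_eq_iff flip: Rep_ell2_inject)
    fix \<xi>
    have "(norm (B \<xi>))\<^sup>2 \<le> (\<Sum>\<^sub>\<infinity>n. (norm A)\<^sup>2 * (norm (Rep_ell2 \<xi> (s n)))\<^sup>2)"
      unfolding norm_ell2 Rep
      by (intro infsum_mono sum summable_on_cmult_right s le)
    also have "\<dots> = (norm \<xi> * norm A)\<^sup>2"
      using infsum_reindex_bij_betw[OF assms(1), of "\<lambda>n. (norm (Rep_ell2 \<xi> n))\<^sup>2"]
      by (simp add: infsum_cmult_right' norm_ell2 power_mult_distrib mult.commute)
    finally show "norm (B \<xi>) \<le> norm \<xi> * norm A"
      by (rule power2_le_imp_le) simp
  qed
qed

lemma amplify_apply: "Rep_ell2 (blinfun_apply (amplify A) \<xi>) n = blinfun_apply A (Rep_ell2 \<xi> n)"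
  using Rep_ell2_shift_apply[OF bij_id, of A]
  by (simp add: amplify_def bounded_linear_Blinfun_apply)

lemma shift_amplify_apply:
  "Rep_ell2 (blinfun_apply (shift_amplify A) \<xi>) n = blinfun_apply A (Rep_ell2 \<xi> (n - 1))"
proof -
  have "bij (\<lambda>n :: int. n - 1)"
    by (rule bijI') (auto intro: exI[of _ "_ + 1"])
  from Rep_ell2_shift_apply[OF this, of A] show ?thesis
    by (simp add: shift_amplify_def bounded_linear_Blinfun_apply)
qed

lemma Rep_ell2_at_zero: "Rep_ell2 (at_zero g) n = (if n = 0 then g else 0)"
proof -
  have "(\<lambda>n :: int. (norm (if n = 0 then g else 0))\<^sup>2) summable_on UNIV \<longleftrightarrow>
      (\<lambda>n :: int. (norm (if n = 0 then g else 0))\<^sup>2) summable_on {0}"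
    by (rule summable_on_cong_neutral) auto
  then show ?thesis
    unfolding at_zero_def by (subst Abs_ell2_inverse) auto
qed

lemma entry_00_apply: "blinfun_apply (entry_00 X) g = Rep_ell2 (blinfun_apply X (at_zero g)) 0"
proof -
  have norm_at_zero: "norm (at_zero g) = norm g" for g :: 'a
  proof -
    have "(\<Sum>\<^sub>\<infinity>n. (norm (Rep_ell2 (at_zero g) n))\<^sup>2) = (\<Sum>\<^sub>\<infinity>n\<in>{0 :: int}. (norm g)\<^sup>2)"
      by (rule infsum_cong_neutral) (auto simp: Rep_ell2_at_zero)
    then have "(norm (at_zero g))\<^sup>2 = (norm g)\<^sup>2"
      by (simp add: norm_ell2)
    then show ?thesis
      by (simp add: power2_eq_iff_nonneg)
  qed
  have norm_Rep: "norm (Rep_ell2 \<xi> 0) \<le> norm \<xi>" for \<xi> :: "'a ell2"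
  proof (rule power2_le_imp_le)
    have "(\<Sum>\<^sub>\<infinity>n\<in>{0}. (norm (Rep_ell2 \<xi> n))\<^sup>2) \<le> (norm \<xi>)\<^sup>2"
      unfolding norm_ell2
      by (rule infsum_mono_neutral) (use Rep_ell2[of \<xi>] in auto)
    then show "(norm (Rep_ell2 \<xi> 0))\<^sup>2 \<le> (norm \<xi>)\<^sup>2" by simp
  qed simp
  have "bounded_linear (\<lambda>g. Rep_ell2 (blinfun_apply X (at_zero g)) 0)"
  proof (rule bounded_linear_intro[where K = "norm X"])
    have "at_zero (g + h) = at_zero g + at_zero h" for g h :: 'a
      by (simp add: Rep_ell2_at_zero Rep_ell2_plus fun_eq_iff flip: Rep_ell2_inject)
    then show "Rep_ell2 (blinfun_apply X (at_zero (g + h))) 0 =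
        Rep_ell2 (blinfun_apply X (at_zero g)) 0 + Rep_ell2 (blinfun_apply X (at_zero h)) 0" for g h
      by (simp add: blinfun.add_right Rep_ell2_plus)
    have "at_zero (r *\<^sub>R g) = r *\<^sub>R at_zero g" for r and g :: 'a
      by (simp add: Rep_ell2_at_zero Rep_ell2_scaleR fun_eq_iff flip: Rep_ell2_inject)
    then show "Rep_ell2 (blinfun_apply X (at_zero (r *\<^sub>R g))) 0 =
        r *\<^sub>R Rep_ell2 (blinfun_apply X (at_zero g)) 0" for r g
      by (simp add: blinfun.scaleR_right Rep_ell2_scaleR)
    show "norm (Rep_ell2 (blinfun_apply X (at_zero g)) 0) \<le> norm g * norm X" for g
      using norm_Rep[of "blinfun_apply X (at_zero g)"] norm_blinfun[of X "at_zero g"]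
      by (simp add: norm_at_zero mult.commute)
  qed
  then show ?thesis
    by (simp add: entry_00_def bounded_linear_Blinfun_apply)
qed

text \<open>For a measure-preserving \<open>T\<close>, the conditional expectation maps finite sums \<open>\<Sum>\<^sub>n M\<^bsub>f\<^sub>n\<^esub> U\<^sup>n\<close> to \<open>f\<^sub>0\<close>;
  the family \<open>W\<close> consists of the integer powers of the unitary.\<close>

lemma cond_exp_finite_sum:
  assumes meas: "inv T \<in> borel_measurable borel"
    and pres: "distr haar haar (inv T) = haar"
    and W: "W 0 = id_blinfun" "\<And>n. W (n + 1) = cp_unitary T o\<^sub>L W n"
    and N: "finite N" "0 \<in> N" "\<And>n. n \<in> N \<Longrightarrow> f n \<in> Linf"
  shows "AE x in haar. cond_exp (\<Sum>n\<in>N. cp_mult (f n) o\<^sub>L W n) x = f (0 :: int) x"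
proof -
  have inj: "blinfun_apply (koopman T) g = 0 \<Longrightarrow> g = 0" for g
    using koopman_apply(2)[OF meas pres, of g] by simp
  have W_apply: "Rep_ell2 (blinfun_apply (W (n + 1)) \<xi>) (k + 1) =
      blinfun_apply (koopman T) (Rep_ell2 (blinfun_apply (W n) \<xi>) k)" for n k \<xi>
    by (simp add: W cp_unitary_def shift_amplify_apply)
  have diag: "Rep_ell2 (blinfun_apply (W n) (at_zero g)) k = 0" if "k \<noteq> n" for n k g
    using that
  proof (induction n arbitrary: k rule: int_induct[where k = 0])
    case base
    then show ?case by (simp add: W Rep_ell2_at_zero)
  next
    case (step1 n)
    then show ?case
      using W_apply[of n "at_zero g" "k - 1"] step1.IH[of "k - 1"] by (simp add: blinfun.zero_right)
  next
    case (step2 n)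
    then show ?case
      using W_apply[of "n - 1" "at_zero g" k] step2.IH[of "k + 1"] by (auto intro: inj)
  qed
  have "Rep_ell2 (blinfun_apply (\<Sum>n\<in>N. cp_mult (f n) o\<^sub>L W n) (at_zero g)) 0 =
      (\<Sum>n\<in>N. blinfun_apply (mult_op (f n)) (Rep_ell2 (blinfun_apply (W n) (at_zero g)) 0))" for g
    using N(1)
    by (induction N)
       (auto simp: blinfun.zero_left blinfun.add_left Rep_ell2_zero Rep_ell2_plus cp_mult_def amplify_apply)
  also have "\<dots> g = blinfun_apply (mult_op (f 0)) g" for g
  proof -
    have "(\<Sum>n\<in>N. blinfun_apply (mult_op (f n)) (Rep_ell2 (blinfun_apply (W n) (at_zero g)) 0)) =
        (\<Sum>n\<in>N. if n = 0 then blinfun_apply (mult_op (f 0)) g else 0)"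
      by (rule sum.cong) (auto simp: diag W Rep_ell2_at_zero blinfun.zero_right)
    then show ?thesis using N by simp
  qed
  finally have "entry_00 (\<Sum>n\<in>N. cp_mult (f n) o\<^sub>L W n) = mult_op (f 0)"
    by (intro blinfun_eqI) (simp add: entry_00_apply)
  then have "cond_exp (\<Sum>n\<in>N. cp_mult (f n) o\<^sub>L W n) \<in> Linf \<and>
      mult_op (cond_exp (\<Sum>n\<in>N. cp_mult (f n) o\<^sub>L W n)) = mult_op (f 0)"
    unfolding cond_exp_def using N by (metis (mono_tags, lifting) someI_ex)
  then show ?thesis
    using N(3)[OF N(2)] mult_op_eq_iff by blast
qed


section \<open>The commutator functional\<close>

definition A_op :: "(torus3 \<Rightarrow> torus3) \<Rightarrow> (nat \<Rightarrow> torus3 \<Rightarrow> complex) \<Rightarrow> nat \<Rightarrow> (L2 ell2 \<Rightarrow>\<^sub>L L2 ell2)"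
  where "A_op T f m = id_blinfun +
    (\<Sum>j=1..m. adj (commutator (cp_unitary T) (cp_mult (f j)))
                 o\<^sub>L commutator (cp_unitary T) (cp_mult (f j)))"

definition S_func :: "(torus3 \<Rightarrow> torus3) \<Rightarrow> (nat \<Rightarrow> torus3 \<Rightarrow> complex) \<Rightarrow> nat \<Rightarrow> complex"
  where "S_func T f m = cp_trace (fun_calc ln (A_op T f m))"

definition h_fun :: "(torus3 \<Rightarrow> torus3) \<Rightarrow> (nat \<Rightarrow> torus3 \<Rightarrow> complex) \<Rightarrow> nat \<Rightarrow> (torus3 \<Rightarrow> real)"
  where "h_fun T f m x = (\<Sum>j=1..m. (cmod (f j x - f j (T x)))\<^sup>2)"

end

(*
  Liouville's theorem is obtained without differentiating the flow in its initial value. Over a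
  time step h the flow agrees up to O(h^2) with the Euler map y + h v(y), which for small h is a
  diffeomorphism of Jacobian 1 + h div v + O(h^2) = 1 + O(h^2). Hence the integral of a compactly
  supported Lipschitz function along the flow changes by O(h^2) per step, so it is constant.

  Once T = Phi_1 preserves the Haar measure, U M_f - M_f U = U M_{f - f o T} with U unitary, so
  every summand of A_F is the multiplication operator by |f_j - f_j o T|^2. Almost every value of
  k lies in the spectrum of M_k (its essential range), so polynomials that converge uniformly on
  the spectrum converge in norm when they are applied to M_k, and log M_k = M_{log k}.
*)

theory Submission
  imports Defs
begin

section \<open>Flows of bounded Lipschitz fields\<close>

text \<open>The flow is known only through curves that solve the equation. Gronwall makes it
  Lipschitz in its initial value, whereas following its Jacobian in time would require the
  variational equation. This is why the test functions are Lipschitz: composing one with the flow up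
  to time t multiplies its constant by at most exp(L t) and enlarges its support by at most V t, so
  the error of a step is uniform over [0, t]. Periodicity supplies the global bounds L and V, and
  since the flow carries the unit cell to another fundamental domain of the integer lattice,
  invariance of Lebesgue measure descends to the torus.

  On the operator side \<open>adj\<close>, \<open>fun_calc\<close> and \<open>cond_exp\<close> are
  description operators: each is evaluated by exhibiting a candidate and proving it unique, for
  \<open>cond_exp\<close> up to null sets. Uniqueness of the logarithm requires that some
  approximating sequence of polynomials exists, so the real spectrum is enclosed in an interval
  where ln is continuous; 1 + h_F >= 1 keeps this interval away from 0.\<close>

lemma ode_dependence_nonneg:
  fixes v :: "'a::real_inner \<Rightarrow> 'a"
  assumes lip: "\<And>x y. norm (v x - v y) \<le> L * norm (x - y)"
    and x: "\<And>t. (x has_vector_derivative v (x t)) (at t)"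
    and y: "\<And>t. (y has_vector_derivative v (y t)) (at t)"
    and "t \<ge> 0"
  shows "norm (x t - y t) \<le> exp (L * t) * norm (x 0 - y 0)"
proof -
  \<comment> \<open>Gronwall in squared form: the squared distance is differentiable even where the
    curves meet, and the weight turns its growth rate 2 L into monotonicity.\<close>
  define w where "w s = exp (- 2 * L * s) * ((x s - y s) \<bullet> (x s - y s))" for s
  have deriv: "(w has_real_derivative exp (- 2 * L * s) *
      (2 * ((x s - y s) \<bullet> (v (x s) - v (y s))) - 2 * L * ((x s - y s) \<bullet> (x s - y s)))) (at s)" for s
  proof -
    have d: "((\<lambda>s. x s - y s) has_derivative (\<lambda>h. h *\<^sub>R (v (x s) - v (y s)))) (at s)"
      using has_vector_derivative_diff[OF x[of s] y[of s]] by (simp add: has_vector_derivative_def)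
    have 1: "((\<lambda>s. (x s - y s) \<bullet> (x s - y s)) has_real_derivative
        2 * ((x s - y s) \<bullet> (v (x s) - v (y s)))) (at s)"
      unfolding has_field_derivative_def
      by (rule has_derivative_eq_rhs[OF has_derivative_inner[OF d d]])
         (auto simp: fun_eq_iff inner_commute algebra_simps)
    have 2: "((\<lambda>s. exp (- 2 * L * s)) has_real_derivative exp (- 2 * L * s) * (- 2 * L)) (at s)"
      by (auto intro!: derivative_eq_intros)
    show ?thesis
      unfolding w_def by (rule DERIV_cong[OF DERIV_mult[OF 2 1]]) (simp add: right_diff_distrib)
  qed
  have le: "(x s - y s) \<bullet> (v (x s) - v (y s)) \<le> L * ((x s - y s) \<bullet> (x s - y s))" for s
  proof -
    have "(x s - y s) \<bullet> (v (x s) - v (y s)) \<le> norm (x s - y s) * norm (v (x s) - v (y s))"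
      by (rule norm_cauchy_schwarz)
    also have "\<dots> \<le> norm (x s - y s) * (L * norm (x s - y s))"
      by (intro mult_left_mono lip) auto
    also have "\<dots> = L * ((x s - y s) \<bullet> (x s - y s))"
      by (simp add: power2_norm_eq_inner[symmetric] power2_eq_square)
    finally show ?thesis .
  qed
  have "w t \<le> w 0"
  proof (rule DERIV_nonpos_imp_nonincreasing[OF \<open>t \<ge> 0\<close>])
    fix s
    show "\<exists>d. (w has_real_derivative d) (at s) \<and> d \<le> 0"
      by (rule exI, rule conjI, rule deriv) (use le[of s] in \<open>simp add: mult_le_0_iff\<close>)
  qed
  then have "exp (- 2 * L * t) * (norm (x t - y t))\<^sup>2 \<le> (norm (x 0 - y 0))\<^sup>2"
    by (simp add: w_def power2_norm_eq_inner)
  then have "exp (2 * L * t) * (exp (- 2 * L * t) * (norm (x t - y t))\<^sup>2)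
      \<le> exp (2 * L * t) * (norm (x 0 - y 0))\<^sup>2"
    by (intro mult_left_mono) auto
  then have "(norm (x t - y t))\<^sup>2 \<le> (exp (L * t) * norm (x 0 - y 0))\<^sup>2"
    by (simp add: power_mult_distrib exp_double[symmetric] mult_exp_exp flip: mult.assoc)
  then show ?thesis
    by (rule power2_le_imp_le) simp
qed

text \<open>Negative times follow by reversal: t -> x(-t) solves the equation of -v, which has the
  same Lipschitz constant.\<close>

lemma ode_dependence:
  fixes v :: "'a::real_inner \<Rightarrow> 'a"
  assumes lip: "\<And>x y. norm (v x - v y) \<le> L * norm (x - y)"
    and x: "\<And>t. (x has_vector_derivative v (x t)) (at t)"
    and y: "\<And>t. (y has_vector_derivative v (y t)) (at t)"
  shows "norm (x t - y t) \<le> exp (L * \<bar>t\<bar>) * norm (x 0 - y 0)"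
proof (cases "t \<ge> 0")
  case True
  then show ?thesis using ode_dependence_nonneg[OF lip x y True] by simp
next
  case False
  have rev: "((\<lambda>t. z (- t)) has_vector_derivative - v (z (- t))) (at t)"
    if "\<And>t. (z has_vector_derivative v (z t)) (at t)" for z t
    using vector_diff_chain_at[of uminus "-1" t z, OF has_vector_derivative_minus[OF has_vector_derivative_id] that]
    by (simp add: o_def)
  show ?thesis
    using ode_dependence_nonneg[of "\<lambda>x. - v x" L "\<lambda>t. x (- t)" "\<lambda>t. y (- t)" "- t",
        OF _ rev[OF x] rev[OF y]] lip False
    by (auto simp: norm_minus_commute)
qed

text \<open>The bounds are global, as they are for the periodic lift of a field on the torus. The
  flow is a datum that solves the equation from every initial point; its group law and continuity
  are consequences of the Gronwall bound.\<close>

locale lipschitz_flow =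
  fixes v :: "'a::euclidean_space \<Rightarrow> 'a" and \<phi> :: "real \<Rightarrow> 'a \<Rightarrow> 'a" and L V :: real
  assumes lip: "norm (v x - v y) \<le> L * norm (x - y)"
    and bound: "norm (v x) \<le> V"
    and L_nonneg: "L \<ge> 0"
    and flow_0: "\<phi> 0 x = x"
    and flow_deriv: "((\<lambda>t. \<phi> t x) has_vector_derivative v (\<phi> t x)) (at t)"
begin

lemma V_nonneg: "V \<ge> 0"
  using bound[of 0] norm_ge_zero order_trans by blast

lemma continuous_on_field: "continuous_on A v"
proof (rule continuous_on_subset)
  have "L-lipschitz_on UNIV v"
    using lip L_nonneg by (auto intro!: lipschitz_onI simp: dist_norm)
  then show "continuous_on UNIV v"
    by (rule lipschitz_on_continuous_on)
qed simp

lemma flow_unique: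
  assumes "\<And>t. (c has_vector_derivative v (c t)) (at t)"
  shows "c t = \<phi> t (c 0)"
  using ode_dependence[OF lip assms flow_deriv, of t "c 0"] by (simp add: flow_0)

text \<open>The field is autonomous, so both sides solve the equation in s from the same initial
  point.\<close>

lemma flow_add: "\<phi> (s + t) x = \<phi> s (\<phi> t x)"
proof -
  have "((\<lambda>s. \<phi> (s + t) x) has_vector_derivative v (\<phi> (s + t) x)) (at s)" for s
  proof -
    have "((\<lambda>s. s + t) has_vector_derivative 1) (at s)"
      by (auto intro!: derivative_eq_intros)
    from vector_diff_chain_at[OF this flow_deriv] show ?thesis
      by (simp add: o_def)
  qed
  from flow_unique[OF this, of s] show ?thesis by simp
qed

lemma flow_lipschitz: "norm (\<phi> t x - \<phi> t y) \<le> exp (L * \<bar>t\<bar>) * norm (x - y)"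
  using ode_dependence[OF lip flow_deriv flow_deriv, of t x y] by (simp add: flow_0)

lemma continuous_on_flow: "continuous_on A (\<phi> t)"
proof (rule continuous_on_subset)
  have "(exp (L * \<bar>t\<bar>))-lipschitz_on UNIV (\<phi> t)"
    using flow_lipschitz[of t] by (auto intro!: lipschitz_onI simp: dist_norm)
  then show "continuous_on UNIV (\<phi> t)"
    by (rule lipschitz_on_continuous_on)
qed simp

lemma flow_inverse: "\<phi> (- t) (\<phi> t x) = x" "\<phi> t (\<phi> (- t) x) = x"
  using flow_add[of "-t" t x] flow_add[of t "-t" x] by (simp_all add: flow_0)

lemma flow_displacement: "norm (\<phi> t x - x) \<le> V * \<bar>t\<bar>"
proof -
  have "norm (\<phi> t x - \<phi> 0 x) \<le> V * norm (t - 0)"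
  proof (rule differentiable_bound[where S = UNIV])
    show "((\<lambda>t. \<phi> t x) has_derivative (\<lambda>h. h *\<^sub>R v (\<phi> s x))) (at s within UNIV)" for s
      using flow_deriv by (auto simp: has_vector_derivative_def)
    show "onorm (\<lambda>h. h *\<^sub>R v (\<phi> s x)) \<le> V" for s
      using bound by (intro onorm_le) (simp add: mult.commute[of V] mult_left_mono)
  qed auto
  then show ?thesis by (simp add: flow_0)
qed

text \<open>On [0, h] the velocity along the orbit differs from the initial one by at most L times
  the displacement V h; the mean value inequality supplies the second factor h.\<close>

lemma flow_euler_step:
  assumes "h \<ge> 0"
  shows "norm (\<phi> h x - (x + h *\<^sub>R v x)) \<le> L * V * h\<^sup>2"
proof -
  have "norm ((\<phi> h x - h *\<^sub>R v x) - (\<phi> 0 x - 0 *\<^sub>R v x)) \<le> L * V * h * norm (h - 0)"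
  proof (rule differentiable_bound[where S = "{0..h}" and f' = "\<lambda>s k. k *\<^sub>R (v (\<phi> s x) - v x)"])
    show "((\<lambda>s. \<phi> s x - s *\<^sub>R v x) has_derivative (\<lambda>k. k *\<^sub>R (v (\<phi> s x) - v x)))
        (at s within {0..h})" for s
    proof (rule has_derivative_at_withinI)
      have "((\<lambda>s. \<phi> s x) has_derivative (\<lambda>k. k *\<^sub>R v (\<phi> s x))) (at s)"
        using flow_deriv[of x s] by (simp add: has_vector_derivative_def)
      moreover have "((\<lambda>s. s *\<^sub>R v x) has_derivative (\<lambda>k. k *\<^sub>R v x)) (at s)"
        by (intro has_derivative_scaleR_left has_derivative_ident)
      ultimately show "((\<lambda>s. \<phi> s x - s *\<^sub>R v x) has_derivative (\<lambda>k. k *\<^sub>R (v (\<phi> s x) - v x))) (at s)"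
        unfolding scaleR_diff_right by (rule has_derivative_diff)
    qed
    fix s assume s: "s \<in> {0..h}"
    have "norm (v (\<phi> s x) - v x) \<le> L * norm (\<phi> s x - x)" by (rule lip)
    also have "\<dots> \<le> L * (V * h)"
    proof (rule mult_left_mono[OF _ L_nonneg])
      have "V * \<bar>s\<bar> \<le> V * h"
        using s V_nonneg by (intro mult_left_mono) auto
      then show "norm (\<phi> s x - x) \<le> V * h"
        using flow_displacement[of s x] by linarith
    qed
    finally show "onorm (\<lambda>k. k *\<^sub>R (v (\<phi> s x) - v x)) \<le> L * V * h"
      by (intro onorm_le) (simp add: mult.commute[of "L * V * h"] mult_left_mono)
  qed (use assms in auto)
  then show ?thesis
    using assms by (simp add: flow_0 algebra_simps power2_eq_square)
qed

text \<open>Surjectivity solves \<open>y = z - h v(y)\<close> by the contraction principle.\<close>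

lemma bij_euler:
  assumes h: "h \<ge> 0" "h * L < 1"
  shows "bij (\<lambda>x. x + h *\<^sub>R v x)"
proof (rule bijI)
  have vh: "norm (h *\<^sub>R v x - h *\<^sub>R v y) \<le> h * L * norm (x - y)" for x y
    using mult_left_mono[OF lip[of x y] h(1)] h(1)
    by (simp add: scaleR_diff_right[symmetric] mult.assoc)
  show "inj (\<lambda>x. x + h *\<^sub>R v x)"
  proof (rule injI, rule ccontr)
    fix x y assume eq: "x + h *\<^sub>R v x = y + h *\<^sub>R v y" and "x \<noteq> y"
    have "norm (x - y) = norm (h *\<^sub>R v x - h *\<^sub>R v y)"
    proof -
      have "x - y = h *\<^sub>R v y - h *\<^sub>R v x"
        using eq by (simp add: algebra_simps)
      then show ?thesis by (simp add: norm_minus_commute)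
    qed
    also have "\<dots> \<le> h * L * norm (x - y)" by (rule vh)
    also have "\<dots> < norm (x - y)" using \<open>x \<noteq> y\<close> h by simp
    finally show False by simp
  qed
  show "surj (\<lambda>x. x + h *\<^sub>R v x)"
    unfolding surj_def
  proof
    fix z
    have "\<exists>!y. z - h *\<^sub>R v y = y"
      using h L_nonneg vh
      by (intro banach_fix_type[of "h * L"]) (auto simp: dist_norm norm_minus_commute)
    then obtain y where "z - h *\<^sub>R v y = y" by blast
    then show "\<exists>y. z = y + h *\<^sub>R v y" by (intro exI[of _ y]) (simp add: algebra_simps)
  qed
qed

end

section \<open>Liouville's theorem\<close>

lemma integrable_on_compact_support:
  fixes G :: "'a::euclidean_space \<Rightarrow> real"
  assumes "continuous_on UNIV G" "\<And>x. norm x > R \<Longrightarrow> G x = 0"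
  shows "G integrable_on UNIV"
proof -
  obtain a :: 'a where "cball 0 R \<subseteq> cbox (- a) a"
    using bounded_subset_cbox_symmetric[OF bounded_cball] by blast
  then have "G x = 0" if "x \<notin> cbox (- a) a" for x
    using that by (intro assms(2)) (force simp: subset_eq)
  moreover have "G integrable_on cbox (- a) a"
    by (rule integrable_continuous[OF continuous_on_subset[OF assms(1)]]) simp
  ultimately show ?thesis
    using integrable_on_superset[of G "cbox (- a) a" UNIV] by simp
qed

lemma integral_bound_cball:
  fixes f :: "'a::euclidean_space \<Rightarrow> real"
  assumes "f integrable_on UNIV" "\<And>x. \<bar>f x\<bar> \<le> B" "\<And>x. norm x > R \<Longrightarrow> f x = 0"
  shows "\<bar>integral UNIV f\<bar> \<le> B * measure lebesgue (cball (0 :: 'a) R)"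
proof -
  have ind: "(indicat_real (cball (0 :: 'a) R) has_integral measure lebesgue (cball (0 :: 'a) R)) UNIV"
    using lmeasurable_cball lmeasurable_iff_indicator_has_integral by blast
  have "norm (integral UNIV f) \<le> integral UNIV (\<lambda>x. B * indicat_real (cball (0 :: 'a) R) x)"
  proof (rule Henstock_Kurzweil_Integration.integral_norm_bound_integral[OF assms(1)])
    show "(\<lambda>x. B * indicat_real (cball (0 :: 'a) R) x) integrable_on UNIV"
      using has_integral_mult_right[OF ind] by blast
    show "norm (f x) \<le> B * indicat_real (cball 0 R) x" for x
      using assms(2)[of x] assms(3)[of x] by (auto simp: indicator_def)
  qed
  also have "\<dots> = B * measure lebesgue (cball (0 :: 'a) R)"
    using has_integral_mult_right[OF ind] by (rule integral_unique)
  finally show ?thesis by simp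
qed

text \<open>The determinant is a cubic polynomial in h whose linear coefficient is the trace. Its
  quadratic coefficient \<open>q\<close> is the sum of the three principal 2x2 minors, hence six
  products of two entries; \<open>det A\<close> consists of six products of three. The condition h
  \<le> 1 absorbs h^3 into h^2.\<close>

lemma det_trace_zero_perturbation:
  fixes A :: "real^3^3"
  assumes A: "\<And>i j. \<bar>A $ i $ j\<bar> \<le> L" and tr: "(\<Sum>i\<in>UNIV. A $ i $ i) = 0"
    and h: "0 \<le> h" "h \<le> 1"
  shows "\<bar>det (mat 1 + h *\<^sub>R A) - 1\<bar> \<le> (6 * L\<^sup>2 + 6 * L ^ 3) * h\<^sup>2"
proof -
  have p2: "\<bar>A $ i $ j * A $ k $ l\<bar> \<le> L\<^sup>2" for i j k l
    unfolding abs_mult power2_eq_square by (intro mult_mono A) (use A[of i j] in auto)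
  have p3: "\<bar>A $ i $ j * A $ k $ l * A $ m $ n\<bar> \<le> L ^ 3" for i j k l m n
  proof -
    have "\<bar>A $ i $ j * A $ k $ l\<bar> * \<bar>A $ m $ n\<bar> \<le> L\<^sup>2 * L"
      by (intro mult_mono p2 A) auto
    then show ?thesis by (simp add: abs_mult power2_eq_square power3_eq_cube)
  qed
  define q where "q = A $ 1 $ 1 * A $ 2 $ 2 - A $ 1 $ 2 * A $ 2 $ 1
    + (A $ 1 $ 1 * A $ 3 $ 3 - A $ 1 $ 3 * A $ 3 $ 1)
    + (A $ 2 $ 2 * A $ 3 $ 3 - A $ 2 $ 3 * A $ 3 $ 2)"
  have det: "det (mat 1 + h *\<^sub>R A) = 1 + h * (\<Sum>i\<in>UNIV. A $ i $ i) + h\<^sup>2 * q + h ^ 3 * det A"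
    unfolding det_3 q_def
    by (simp add: mat_def sum_3) algebra
  have "\<bar>q\<bar> \<le> 6 * L\<^sup>2"
    unfolding q_def
    using p2[of 1 1 2 2] p2[of 1 2 2 1] p2[of 1 1 3 3] p2[of 1 3 3 1] p2[of 2 2 3 3] p2[of 2 3 3 2]
    by linarith
  moreover have "\<bar>det A\<bar> \<le> 6 * L ^ 3"
    unfolding det_3
    using p3[of 1 1 2 2 3 3] p3[of 1 2 2 3 3 1] p3[of 1 3 2 1 3 2] p3[of 1 1 2 3 3 2]
      p3[of 1 2 2 1 3 3] p3[of 1 3 2 2 3 1]
    by linarith
  moreover have "h ^ 3 * \<bar>det A\<bar> \<le> h\<^sup>2 * \<bar>det A\<bar>"
    using h by (intro mult_right_mono power_decreasing) auto
  ultimately have "h\<^sup>2 * \<bar>q\<bar> + h ^ 3 * \<bar>det A\<bar> \<le> h\<^sup>2 * (6 * L\<^sup>2) + h\<^sup>2 * (6 * L ^ 3)"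
    by (smt (verit) mult_left_mono zero_le_power2)
  moreover have "\<bar>h\<^sup>2 * q + h ^ 3 * det A\<bar> \<le> h\<^sup>2 * \<bar>q\<bar> + h ^ 3 * \<bar>det A\<bar>"
    using abs_triangle_ineq[of "h\<^sup>2 * q" "h ^ 3 * det A"] h by (simp add: abs_mult)
  ultimately show ?thesis
    unfolding det tr by (simp add: algebra_simps)
qed

text \<open>The change of variables theorem is applied to a function with values in
  \<open>real^1\<close>; \<open>vec\<close> passes between it and the real function
  \<open>G\<close>.\<close>

lemma integral_change_of_variables_bij:
  fixes G :: "real^'n::{finite,wellorder} \<Rightarrow> real" and e :: "real^'n::_ \<Rightarrow> real^'n::_"
  assumes der: "\<And>x. (e has_derivative e' x) (at x)" and "bij e"
    and G: "G absolutely_integrable_on UNIV"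
  shows "((\<lambda>x. \<bar>det (matrix (e' x))\<bar> * G (e x)) has_integral integral UNIV G) UNIV"
proof -
  have img: "range e = UNIV" "inj e"
    using \<open>bij e\<close> by (auto simp: bij_def)
  have "(vec \<circ> G :: real^'n::_ \<Rightarrow> real^1) absolutely_integrable_on range e \<and>
      integral (range e) (vec \<circ> G :: real^'n::_ \<Rightarrow> real^1) = vec (integral UNIV G)"
    using G by (simp add: img absolutely_integrable_on_1_iff integral_on_1_eq o_def)
  then have "(\<lambda>x. \<bar>det (matrix (e' x))\<bar> *\<^sub>R (vec \<circ> G) (e x) :: real^1) absolutely_integrable_on UNIV \<and>
      integral UNIV (\<lambda>x. \<bar>det (matrix (e' x))\<bar> *\<^sub>R (vec \<circ> G) (e x) :: real^1) = vec (integral UNIV G)"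
    using has_absolute_integral_change_of_variables[of UNIV e e' "vec \<circ> G :: real^'n::_ \<Rightarrow> real^1"] der img
    by simp
  then show ?thesis
    by (simp add: absolutely_integrable_on_1_iff integral_on_1_eq o_def has_integral_iff
        set_lebesgue_integral_eq_integral)
qed

text \<open>\<open>div\<close> is the trace of the Jacobian matrix. One constant L serves as
  Lipschitz constant and as bound of the derivative, since the mean value inequality gives the first
  from the second.\<close>

locale divergence_free_flow = lipschitz_flow v \<phi> L V
  for v :: "real^3 \<Rightarrow> real^3" and \<phi> L V +
  fixes D :: "real^3 \<Rightarrow> real^3 \<Rightarrow> real^3"
  assumes deriv: "(v has_derivative D x) (at x)"
    and D_bound: "norm (D x y) \<le> L * norm y"
    and div: "(\<Sum>i\<in>UNIV. D x (axis i 1) $ i) = 0"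
begin

text \<open>By change of variables the two integrals differ by the integral of (1 - |det e'|) G(e
  x), which the determinant estimate controls. For h \<le> 1 the Euler map moves points by at most
  V, whence the ball of radius R + V.\<close>

lemma euler_integral:
  assumes G: "continuous_on UNIV G" "\<And>x. norm x > R \<Longrightarrow> G x = 0" "\<And>x. \<bar>G x\<bar> \<le> M"
    and h: "0 \<le> h" "h \<le> 1" "h * L < 1"
  shows "\<bar>integral UNIV (\<lambda>x. G (x + h *\<^sub>R v x)) - integral UNIV G\<bar>
    \<le> (6 * L\<^sup>2 + 6 * L ^ 3) * h\<^sup>2 * M * measure lebesgue (cball (0 :: real^3) (R + V))"
proof -
  define e where "e x = x + h *\<^sub>R v x" for x
  define e' where "e' x y = y + h *\<^sub>R D x y" for x y
  have der: "(e has_derivative e' x) (at x)" for x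
    unfolding e_def[abs_def] e'_def[abs_def]
    by (intro has_derivative_add has_derivative_ident has_derivative_scaleR_right deriv)
  have lin: "linear (D x)" for x
    using deriv has_derivative_linear by blast
  have det: "\<bar>\<bar>det (matrix (e' x))\<bar> - 1\<bar> \<le> (6 * L\<^sup>2 + 6 * L ^ 3) * h\<^sup>2" for x
  proof -
    have "matrix (e' x) = mat 1 + h *\<^sub>R matrix (D x)"
      by (simp add: vec_eq_iff matrix_def e'_def mat_def axis_def)
    moreover have "\<bar>matrix (D x) $ i $ j\<bar> \<le> L" for i j
      using component_le_norm_cart[of "D x (axis j 1)" i] D_bound[of x "axis j 1"]
      by (simp add: matrix_def)
    moreover have "(\<Sum>i\<in>UNIV. matrix (D x) $ i $ i) = 0"
      using div[of x] by (simp add: matrix_def)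
    ultimately have "\<bar>det (matrix (e' x)) - 1\<bar> \<le> (6 * L\<^sup>2 + 6 * L ^ 3) * h\<^sup>2"
      using det_trace_zero_perturbation[of "matrix (D x)" L h] h by simp
    then show ?thesis by linarith
  qed
  have cont_e: "continuous_on UNIV e"
    unfolding e_def[abs_def] by (intro continuous_intros continuous_on_field)
  have norm_e: "norm x \<le> norm (e x) + V" for x
  proof -
    have "norm (h *\<^sub>R v x) \<le> 1 * V"
      unfolding norm_scaleR by (rule mult_mono) (use h bound in auto)
    then show ?thesis
      using norm_triangle_ineq4[of "e x" "h *\<^sub>R v x"] by (simp add: e_def)
  qed
  then have supp: "G (e x) = 0" if "norm x > R + V" for x
    using that norm_e[of x] by (intro G(2)) linarith
  have "G integrable_on UNIV" "(\<lambda>x. norm (G x)) integrable_on UNIV"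
    by (rule integrable_on_compact_support[where R = R]; use G in \<open>auto intro!: continuous_intros\<close>)+
  then have chg: "((\<lambda>x. \<bar>det (matrix (e' x))\<bar> * G (e x)) has_integral integral UNIV G) UNIV"
    using bij_euler[OF h(1,3)]
    by (intro integral_change_of_variables_bij der absolutely_integrable_onI)
       (simp_all add: e_def[abs_def])
  have Ge: "(\<lambda>x. G (e x)) integrable_on UNIV"
    using supp
    by (intro integrable_on_compact_support[where R = "R + V"] continuous_on_compose2[OF G(1) cont_e]) auto
  let ?d = "\<lambda>x. G (e x) - \<bar>det (matrix (e' x))\<bar> * G (e x)"
  have d: "?d integrable_on UNIV"
    "integral UNIV ?d = integral UNIV (\<lambda>x. G (e x)) - integral UNIV G"
    using has_integral_diff[OF integrable_integral[OF Ge] chg] by auto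
  have "\<bar>integral UNIV ?d\<bar> \<le>
      (6 * L\<^sup>2 + 6 * L ^ 3) * h\<^sup>2 * M * measure lebesgue (cball (0 :: real^3) (R + V))"
  proof (rule integral_bound_cball[OF d(1)])
    fix x
    have "?d x = (1 - \<bar>det (matrix (e' x))\<bar>) * G (e x)"
      by (simp add: algebra_simps)
    then have "\<bar>?d x\<bar> = \<bar>\<bar>det (matrix (e' x))\<bar> - 1\<bar> * \<bar>G (e x)\<bar>"
      by (simp add: abs_mult abs_minus_commute)
    also have "\<dots> \<le> (6 * L\<^sup>2 + 6 * L ^ 3) * h\<^sup>2 * M"
      using L_nonneg by (intro mult_mono det G) auto
    finally show "\<bar>?d x\<bar> \<le> (6 * L\<^sup>2 + 6 * L ^ 3) * h\<^sup>2 * M" .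
  qed (simp add: supp)
  then show ?thesis
    unfolding d(2) by (simp add: e_def)
qed

text \<open>Two errors of order h^2 add up: K L V from replacing the flow by the Euler map inside
  \<open>G\<close>, and the determinant term from the Euler map itself.\<close>

lemma flow_integral_step:
  assumes G: "\<And>x y. \<bar>G x - G y\<bar> \<le> K * norm (x - y)" "\<And>x. norm x > R \<Longrightarrow> G x = 0"
      "\<And>x. \<bar>G x\<bar> \<le> M"
    and h: "0 \<le> h" "h \<le> 1" "h * L < 1" and K: "0 \<le> K"
  shows "\<bar>integral UNIV (\<lambda>x. G (\<phi> h x)) - integral UNIV G\<bar>
    \<le> (K * L * V + (6 * L\<^sup>2 + 6 * L ^ 3) * M) * measure lebesgue (cball (0 :: real^3) (R + V)) * h\<^sup>2"
proof -
  let ?m = "measure lebesgue (cball (0 :: real^3) (R + V))"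
  let ?e = "\<lambda>x. x + h *\<^sub>R v x"
  have "K-lipschitz_on UNIV G"
    using G(1) K by (auto intro!: lipschitz_onI simp: dist_norm)
  then have contG: "continuous_on UNIV G"
    by (rule lipschitz_on_continuous_on)
  have cont_e: "continuous_on UNIV ?e"
    by (intro continuous_intros continuous_on_field)
  have Vh: "V * h \<le> V"
    using h V_nonneg by (simp add: mult_left_le)
  have out: "norm (\<phi> h x) > R" "norm (?e x) > R" if "norm x > R + V" for x
  proof -
    have "norm (\<phi> h x - x) \<le> V"
      using flow_displacement[of h x] h Vh by simp
    then show "norm (\<phi> h x) > R"
      using norm_triangle_ineq4[of "\<phi> h x" "\<phi> h x - x"] that by simp
    have "norm (h *\<^sub>R v x) \<le> V"
      using mult_left_mono[OF bound[of x] h(1)] h(1) Vh by (simp add: mult.commute)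
    then show "norm (?e x) > R"
      using norm_triangle_ineq4[of "?e x" "h *\<^sub>R v x"] that by simp
  qed
  have int: "(\<lambda>x. G (\<phi> h x)) integrable_on UNIV" "(\<lambda>x. G (?e x)) integrable_on UNIV"
    using out G(2)
    by (intro integrable_on_compact_support[where R = "R + V"]
        continuous_on_compose2[OF contG continuous_on_flow] continuous_on_compose2[OF contG cont_e]; auto)+
  have "\<bar>integral UNIV (\<lambda>x. G (\<phi> h x) - G (?e x))\<bar> \<le> (K * (L * V * h\<^sup>2)) * ?m"
  proof (rule integral_bound_cball)
    show "\<bar>G (\<phi> h x) - G (?e x)\<bar> \<le> K * (L * V * h\<^sup>2)" for x
      using G(1)[of "\<phi> h x" "?e x"] mult_left_mono[OF flow_euler_step[OF h(1), of x] K] by linarith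
  qed (use out G(2) int in \<open>auto intro: integrable_diff\<close>)
  then have "\<bar>integral UNIV (\<lambda>x. G (\<phi> h x)) - integral UNIV (\<lambda>x. G (?e x))\<bar> \<le> K * (L * V * h\<^sup>2) * ?m"
    by (simp add: Henstock_Kurzweil_Integration.integral_diff int)
  moreover have "\<bar>integral UNIV (\<lambda>x. G (?e x)) - integral UNIV G\<bar>
      \<le> (6 * L\<^sup>2 + 6 * L ^ 3) * h\<^sup>2 * M * ?m"
    by (rule euler_integral[OF contG G(2,3) h])
  ultimately show ?thesis
    by (simp add: algebra_simps abs_le_iff)
qed

text \<open>Splitting \<open>[0, t]\<close> into \<open>n\<close> steps, each step changes the integral by \<open>O(n\<^sup>-\<^sup>2)\<close> only.\<close>

lemma flow_integral_invariant:
  assumes g: "\<And>x y. \<bar>g x - g y\<bar> \<le> K * norm (x - y)" "\<And>x. norm x > R \<Longrightarrow> g x = 0"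
      "\<And>x. \<bar>g x\<bar> \<le> M"
    and K: "0 \<le> K" and t: "0 \<le> t"
  shows "integral UNIV (\<lambda>x. g (\<phi> t x)) = integral UNIV g"
proof -
  define F where "F s = integral UNIV (\<lambda>x. g (\<phi> s x))" for s
  \<comment> \<open>The constant of \<open>flow_integral_step\<close> for the test function g o
    \<phi>_s, made uniform in s: exp(L t) bounds the growth of the Lipschitz constant and V t that
    of the support.\<close>
  define C where "C = (K * exp (L * t) * L * V + (6 * L\<^sup>2 + 6 * L ^ 3) * M)
    * measure lebesgue (cball (0 :: real^3) (R + V * t + V))"
  have step: "\<bar>F (s + h) - F s\<bar> \<le> C * h\<^sup>2" if s: "0 \<le> s" "s \<le> t" and h: "0 \<le> h" "h \<le> 1" "h * L < 1" for s h
  proof -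
    \<comment> \<open>The small step is taken first and the long flow is put into the test function,
      so that the one-step estimate, which starts from the identity, applies.\<close>
    have "F (s + h) = integral UNIV (\<lambda>x. g (\<phi> s (\<phi> h x)))"
      unfolding F_def by (simp add: flow_add)
    moreover have "\<bar>integral UNIV (\<lambda>x. g (\<phi> s (\<phi> h x))) - integral UNIV (\<lambda>x. g (\<phi> s x))\<bar> \<le> C * h\<^sup>2"
      unfolding C_def
    proof (rule flow_integral_step)
      fix x y
      have "\<bar>g (\<phi> s x) - g (\<phi> s y)\<bar> \<le> K * norm (\<phi> s x - \<phi> s y)" by (rule g)
      also have "\<dots> \<le> K * (exp (L * t) * norm (x - y))"
      proof (rule mult_left_mono[OF _ K])
        have "exp (L * \<bar>s\<bar>) * norm (x - y) \<le> exp (L * t) * norm (x - y)"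
          using s L_nonneg by (intro mult_right_mono) (auto intro: mult_left_mono)
        then show "norm (\<phi> s x - \<phi> s y) \<le> exp (L * t) * norm (x - y)"
          using flow_lipschitz[of s x y] by linarith
      qed
      finally show "\<bar>g (\<phi> s x) - g (\<phi> s y)\<bar> \<le> K * exp (L * t) * norm (x - y)" by simp
    next
      fix x :: "real^3" assume x: "norm x > R + V * t"
      have "V * \<bar>s\<bar> \<le> V * t" using s V_nonneg by (intro mult_left_mono) auto
      then have "norm (\<phi> s x - x) \<le> V * t"
        using flow_displacement[of s x] by linarith
      then show "g (\<phi> s x) = 0"
        using norm_triangle_ineq4[of "\<phi> s x" "\<phi> s x - x"] x by (intro g(2)) simp
    qed (use g h K in auto)
    ultimately show ?thesis by (simp add: F_def)
  qed
  \<comment> \<open>The threshold gives h (1 + L) < 1, which secures h \<le> 1 and h L < 1 at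
    once.\<close>
  have bnd: "\<bar>F t - F 0\<bar> \<le> C * t\<^sup>2 * inverse (real n)" if n: "real n > t * (1 + L)" "n > 0" for n
  proof -
    define h where "h = t / n"
    have hb: "h * (1 + L) < 1" "0 \<le> h"
      using n t by (auto simp: h_def field_simps)
    then have h: "0 \<le> h" "h \<le> 1" "h * L < 1"
      using mult_nonneg_nonneg[OF hb(2) L_nonneg] by (auto simp: distrib_left)
    have "\<bar>F (k * h) - F 0\<bar> \<le> k * (C * h\<^sup>2)" if "k \<le> n" for k :: nat
      using that
    proof (induction k)
      case (Suc k)
      have "real k * h \<le> t"
        using Suc.prems n t by (simp add: h_def field_simps mult_left_mono)
      then have "\<bar>F (k * h + h) - F (k * h)\<bar> \<le> C * h\<^sup>2"
        using h by (intro step) auto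
      moreover have "\<bar>F (k * h) - F 0\<bar> \<le> k * (C * h\<^sup>2)"
        using Suc by simp
      ultimately have "\<bar>F (k * h + h) - F 0\<bar> \<le> k * (C * h\<^sup>2) + C * h\<^sup>2" by linarith
      then show ?case by (simp add: algebra_simps)
    qed simp
    from this[of n] show ?thesis
      using n by (simp add: h_def power2_eq_square field_simps)
  qed
  have "\<bar>F t - F 0\<bar> \<le> 0"
  proof (rule tendsto_lowerbound)
    show "(\<lambda>n. C * t\<^sup>2 * inverse (real n)) \<longlonglongrightarrow> 0"
      using tendsto_mult_left[OF lim_inverse_n, of "C * t\<^sup>2"] by simp
    show "\<forall>\<^sub>F n in sequentially. \<bar>F t - F 0\<bar> \<le> C * t\<^sup>2 * inverse (real n)"
      using filterlim_real_sequentially[unfolded filterlim_at_top_dense, rule_format, of "t * (1 + L)"]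
        eventually_gt_at_top[of 0]
      by eventually_elim (rule bnd)
  qed simp
  then show ?thesis by (simp add: F_def flow_0)
qed

text \<open>Lebesgue measure is determined by its values on open boxes. The indicator of a box is
  the increasing limit of the truncated multiples \<open>g n\<close> of the distance to its
  complement, which are Lipschitz with compact support, so invariance of their integrals passes to
  the box by monotone convergence.\<close>

theorem flow_preserves_lborel:
  assumes t: "t \<ge> 0"
  shows "distr lborel borel (\<phi> t) = lborel"
proof (rule lborel_eqI[symmetric])
  fix l u :: "real^3"
  assume lu: "\<And>b. b \<in> Basis \<Longrightarrow> l \<bullet> b \<le> u \<bullet> b"
  have [measurable]: "\<phi> t \<in> borel_measurable borel"
    by (intro borel_measurable_continuous_onI continuous_on_flow)
  define g where "g n x = min 1 (real n * infdist x (- box l u))" for n :: nat and x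
  have [measurable]: "g n \<in> borel_measurable borel" for n
    unfolding g_def[abs_def] by (intro borel_measurable_continuous_onI continuous_intros)
  have g01: "0 \<le> g n x" "g n x \<le> 1" for n x
    by (simp_all add: g_def infdist_nonneg)
  obtain R where R: "\<And>x. x \<in> box l u \<Longrightarrow> norm x \<le> R"
    using bounded_box[of l u] unfolding bounded_iff by blast
  have supp: "g n x = 0" if "norm x > R" for n x
  proof -
    have "x \<in> - box l u"
      using that R[of x] by auto
    then show ?thesis by (simp add: g_def)
  qed
  have lipg: "\<bar>g n x - g n y\<bar> \<le> real n * norm (x - y)" for n x y
  proof -
    have "\<bar>g n x - g n y\<bar> \<le> \<bar>real n * infdist x (- box l u) - real n * infdist y (- box l u)\<bar>"
      unfolding g_def by linarith
    also have "\<dots> = real n * \<bar>infdist x (- box l u) - infdist y (- box l u)\<bar>"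
      by (simp add: abs_mult right_diff_distrib[symmetric])
    also have "\<dots> \<le> real n * norm (x - y)"
      using infdist_triangle_abs[of x "- box l u" y] by (intro mult_left_mono) (auto simp: dist_norm)
    finally show ?thesis .
  qed
  have contg: "continuous_on UNIV (g n)" for n
    unfolding g_def[abs_def] by (intro continuous_intros)
  have int: "g n integrable_on UNIV" for n
    using supp contg by (rule integrable_on_compact_support[rotated])
  have inv: "integral UNIV (\<lambda>x. g n (\<phi> t x)) = integral UNIV (g n)" for n
    by (rule flow_integral_invariant[OF lipg supp _ _ t, where M = 1]) (use g01 in \<open>auto simp: abs_le_iff intro: order_trans\<close>)
  have int': "(\<lambda>x. g n (\<phi> t x)) integrable_on UNIV" for n
  proof (rule integrable_on_compact_support[where R = "R + V * t"])
    show "continuous_on UNIV (\<lambda>x. g n (\<phi> t x))"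
      by (rule continuous_on_compose2[OF contg continuous_on_flow]) auto
    show "g n (\<phi> t x) = 0" if "norm x > R + V * t" for x
      using norm_triangle_ineq4[of "\<phi> t x" "\<phi> t x - x"] flow_displacement[of t x] t that
      by (intro supp) simp
  qed
  have nn: "(\<integral>\<^sup>+x. g n (\<phi> t x) \<partial>lborel) = (\<integral>\<^sup>+x. g n x \<partial>lborel)" for n
    using nn_integral_has_integral_lborel[of "g n", OF _ g01(1) integrable_integral[OF int]]
      nn_integral_has_integral_lborel[of "\<lambda>x. g n (\<phi> t x)", OF _ g01(1) integrable_integral[OF int']] inv[of n]
    by simp
  have mono: "incseq (\<lambda>n x. ennreal (g n x))"
    unfolding g_def
    by (intro incseq_SucI le_funI ennreal_leI min.mono mult_right_mono infdist_nonneg) auto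
  \<comment> \<open>The distance to the empty set is 0 by convention, so positivity of
    \<open>infdist\<close> on the box rests on a nonempty complement.\<close>
  have ne: "- box l u \<noteq> {}"
    using bounded_box[of l u] not_bounded_UNIV[where 'a = "real^3"] by (metis Compl_empty_eq double_complement)
  have sup: "(SUP n. ennreal (g n x)) = indicator (box l u) x" for x
  proof (cases "x \<in> box l u")
    case True
    then have pos: "infdist x (- box l u) > 0"
      using ne by (intro infdist_pos_not_in_closed) (auto simp: closed_Compl)
    then obtain n :: nat where "1 \<le> real n * infdist x (- box l u)"
      by (metis ex_less_of_nat_mult less_imp_le)
    then have "1 \<le> (SUP n. ennreal (g n x))"
      by (intro SUP_upper2[of n]) (auto simp: g_def min_def)
    moreover have "(SUP n. ennreal (g n x)) \<le> 1"
      using g01 by (intro SUP_least) simp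
    ultimately have "(SUP n. ennreal (g n x)) = 1"
      by (rule antisym[rotated])
    then show ?thesis using True by simp
  next
    case False
    then have "g n x = 0" for n
      by (simp add: g_def)
    then show ?thesis using False by simp
  qed
  have *: "(\<integral>\<^sup>+x. indicator (box l u) (f x) \<partial>lborel) = (SUP n. \<integral>\<^sup>+x. g n (f x) \<partial>lborel)"
    if [measurable]: "f \<in> borel_measurable borel" for f :: "real^3 \<Rightarrow> real^3"
    unfolding sup[symmetric]
    by (rule nn_integral_monotone_convergence_SUP) (use mono in \<open>auto simp: incseq_def le_fun_def\<close>)
  have "emeasure (distr lborel borel (\<phi> t)) (box l u) = (\<integral>\<^sup>+x. indicator (box l u) (\<phi> t x) \<partial>lborel)"
    by (simp add: nn_integral_distr flip: nn_integral_indicator)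
  also have "\<dots> = (\<integral>\<^sup>+x. indicator (box l u) x \<partial>lborel)"
    using *[of "\<phi> t"] *[of "\<lambda>x. x"] by (simp add: nn)
  also have "\<dots> = emeasure lborel (box l u)"
    by simp
  finally show "emeasure (distr lborel borel (\<phi> t)) (box l u) = (\<Prod>b\<in>Basis. (u - l) \<bullet> b)"
    using lu by (simp add: emeasure_lborel_box_eq)
qed simp

end

section \<open>Flows on the torus\<close>

definition int_vecs :: "(real^'n) set"
  where "int_vecs = {k. \<forall>i. k $ i \<in> \<int>}"

lemma countable_int_vecs: "countable (int_vecs :: (real^'n) set)"
proof -
  have "int_vecs \<subseteq> range (\<lambda>f :: 'n \<Rightarrow> int. \<chi> i. real_of_int (f i))"
  proof
    fix k :: "real^'n" assume "k \<in> int_vecs"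
    then have "k = (\<chi> i. real_of_int \<lfloor>k $ i\<rfloor>)"
      by (auto simp: int_vecs_def vec_eq_iff elim!: Ints_cases)
    then show "k \<in> range (\<lambda>f :: 'n \<Rightarrow> int. \<chi> i. real_of_int (f i))"
      by (rule range_eqI[where x = "\<lambda>i. \<lfloor>k $ i\<rfloor>"])
  qed
  then show ?thesis
    by (rule countable_subset) (rule countableI_type[THEN countable_image])
qed

lemma int_vecs_uminus: "k \<in> int_vecs \<Longrightarrow> - k \<in> int_vecs"
  by (auto simp: int_vecs_def)

lemma torus_proj_eq_iff: "torus_proj x = torus_proj y \<longleftrightarrow> x - y \<in> int_vecs"
  by (simp add: torus3.abs_eq_iff int_vecs_def)

lemma torus_proj_plus_int: "k \<in> int_vecs \<Longrightarrow> torus_proj (x + k) = torus_proj x"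
  by (simp add: torus_proj_eq_iff)

lemma ex_torus_proj: "\<exists>x. torus_proj x = z"
  using Quotient_abs_rep[OF Quotient_torus3] by blast

lemma unit_cell_tiles: "\<exists>!k. k \<in> int_vecs \<and> x + k \<in> unit_cell"
proof (rule ex1I)
  show "(\<chi> i. - real_of_int \<lfloor>x $ i\<rfloor>) \<in> int_vecs \<and> x + (\<chi> i. - real_of_int \<lfloor>x $ i\<rfloor>) \<in> unit_cell"
    by (auto simp: int_vecs_def unit_cell_def) linarith
  fix k assume k: "k \<in> int_vecs \<and> x + k \<in> unit_cell"
  show "k = (\<chi> i. - real_of_int \<lfloor>x $ i\<rfloor>)"
  proof (subst vec_eq_iff, intro allI)
    fix i
    obtain n where n: "k $ i = of_int n"
      using k by (auto simp: int_vecs_def elim: Ints_cases)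
    have "0 \<le> x $ i + of_int n" "x $ i + of_int n < 1"
      using k n[symmetric] by (auto simp: unit_cell_def)
    then have "\<lfloor>x $ i\<rfloor> = - n"
      by (intro floor_unique) auto
    then show "k $ i = (\<chi> i. - real_of_int \<lfloor>x $ i\<rfloor>) $ i"
      by (simp add: n)
  qed
qed

lemma emeasure_translate:
  fixes A :: "'a::euclidean_space set"
  assumes "A \<in> sets borel"
  shows "emeasure lborel {x. x + k \<in> A} = emeasure lborel A"
proof -
  have "emeasure lborel A = emeasure (distr lborel borel ((+) k)) A"
    by (simp add: lborel_distr_plus)
  also have "\<dots> = emeasure lborel {x. x + k \<in> A}"
    using assms by (subst emeasure_distr) (auto simp: vimage_def add.commute)
  finally show ?thesis ..
qed

text \<open>Two fundamental domains are equidecomposable: cut \<open>D\<close> according to the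
  integer vector k that carries a point into \<open>E\<close> and translate each piece by its k. The
  translated pieces tile \<open>E\<close>, and the periodic set \<open>P\<close> is
  respected.\<close>

lemma emeasure_fundamental_domain_eq:
  fixes D E P :: "(real^'n) set"
  assumes [measurable]: "D \<in> sets borel" "E \<in> sets borel" "P \<in> sets borel"
    and D: "\<And>x. \<exists>!k. k \<in> int_vecs \<and> x + k \<in> D"
    and E: "\<And>x. \<exists>!k. k \<in> int_vecs \<and> x + k \<in> E"
    and P: "\<And>x k. k \<in> int_vecs \<Longrightarrow> x + k \<in> P \<longleftrightarrow> x \<in> P"
  shows "emeasure lborel (D \<inter> P) = emeasure lborel (E \<inter> P)"
proof -
  have "D \<inter> P = (\<Union>k\<in>int_vecs. {x. x \<in> D \<and> x \<in> P \<and> x + k \<in> E})"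
    using E by blast
  then have "emeasure lborel (D \<inter> P) =
      (\<integral>\<^sup>+k. emeasure lborel {x. x \<in> D \<and> x \<in> P \<and> x + k \<in> E} \<partial>count_space int_vecs)"
    by (simp only:, intro emeasure_UN_countable countable_int_vecs)
       (use E in \<open>auto simp: disjoint_family_on_def\<close>)
  also have "\<dots> = (\<integral>\<^sup>+k. emeasure lborel {y. y + - k \<in> D \<and> y \<in> P \<and> y \<in> E} \<partial>count_space int_vecs)"
  proof (rule nn_integral_cong)
    fix k :: "real^'n" assume "k \<in> space (count_space int_vecs)"
    then have k: "k \<in> int_vecs" by simp
    have "{x. x \<in> D \<and> x \<in> P \<and> x + k \<in> E} = {x. x + k \<in> {y. y + - k \<in> D \<and> y \<in> P \<and> y \<in> E}}"
      using P[OF k] by auto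
    then show "emeasure lborel {x. x \<in> D \<and> x \<in> P \<and> x + k \<in> E} =
        emeasure lborel {y. y + - k \<in> D \<and> y \<in> P \<and> y \<in> E}"
      by (simp only:, intro emeasure_translate) measurable
  qed
  also have "\<dots> = emeasure lborel (\<Union>k\<in>int_vecs. {y. y + - k \<in> D \<and> y \<in> P \<and> y \<in> E})"
  proof (rule emeasure_UN_countable[symmetric])
    have "k = l" if "k \<in> int_vecs" "l \<in> int_vecs" "y + - k \<in> D" "y + - l \<in> D" for k l y
      using D[of y] that int_vecs_uminus by (metis minus_equation_iff)
    then show "disjoint_family_on (\<lambda>k. {y. y + - k \<in> D \<and> y \<in> P \<and> y \<in> E}) int_vecs"
      unfolding disjoint_family_on_def by blast
  qed (use countable_int_vecs in auto)
  also have "(\<Union>k\<in>int_vecs. {y. y + - k \<in> D \<and> y \<in> P \<and> y \<in> E}) = E \<inter> P"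
  proof -
    have "\<exists>k\<in>int_vecs. y + - k \<in> D" for y
      using D[of y] int_vecs_uminus by (metis minus_minus)
    then show ?thesis by blast
  qed
  finally show ?thesis .
qed

lemma unit_cell_borel: "unit_cell \<in> sets borel"
  unfolding unit_cell_def by measurable

lemma emeasure_haar:
  assumes "B \<in> sets borel"
  shows "emeasure haar B = emeasure lborel (unit_cell \<inter> torus_proj -` B)"
proof -
  have [measurable]: "torus_proj -` B \<in> sets borel"
    using measurable_sets[OF torus_proj_measurable assms] by simp
  have "emeasure haar B = emeasure (restrict_space lborel unit_cell) (torus_proj -` B \<inter> unit_cell)"
    unfolding haar_def using assms
    by (subst emeasure_distr)
       (auto simp: space_restrict_space intro!: measurable_restrict_space1 torus_proj_measurable)
  also have "\<dots> = emeasure lborel (unit_cell \<inter> torus_proj -` B)"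
    using unit_cell_borel by (subst emeasure_restrict_space) (auto simp: Int_commute)
  finally show ?thesis .
qed

lemma bounded_range_periodic:
  fixes G :: "real^3 \<Rightarrow> 'b::real_normed_vector"
  assumes "continuous_on UNIV G" and per: "\<And>x k. k \<in> int_vecs \<Longrightarrow> G (x + k) = G x"
  shows "bounded (range G)"
proof -
  have "range G \<subseteq> G ` cbox 0 (\<chi> i. 1)"
  proof
    fix z assume "z \<in> range G"
    then obtain x k where "z = G x" "k \<in> int_vecs" "x + k \<in> unit_cell"
      using unit_cell_tiles by blast
    then have "z = G (x + k)" "x + k \<in> cbox 0 (\<chi> i. 1)"
      using per by (auto simp: unit_cell_def mem_box_cart less_imp_le)
    then show "z \<in> G ` cbox 0 (\<chi> i. 1)" by blast
  qed
  moreover have "compact (G ` cbox 0 (\<chi> i. 1))"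
    using assms(1) by (intro compact_continuous_image) (auto intro: continuous_on_subset)
  ultimately show ?thesis
    using bounded_subset compact_imp_bounded by blast
qed

section \<open>Lifting the flow to the covering space and projecting back\<close>

text \<open>The solutions that witness \<open>is_flow\<close> are moved by integer vectors to start at a given
  point; no existence theorem for ordinary differential equations is needed.\<close>

lemma torus_flow_lift:
  assumes C1: "C1_field u" and div: "divergence_free u" and flow: "is_flow u \<Phi>"
  obtains \<phi> L V D where "divergence_free_flow (\<lambda>y. u (torus_proj y)) \<phi> L V D"
    and "\<And>t y. torus_proj (\<phi> t y) = \<Phi> t (torus_proj y)"
proof -
  define v where "v y = u (torus_proj y)" for y
  have per: "v (y + k) = v y" if "k \<in> int_vecs" for y k
    using that by (simp add: v_def torus_proj_plus_int)
  obtain D where D: "\<And>x. (v has_derivative blinfun_apply (D x)) (at x)"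
    and contD: "continuous_on UNIV D"
    using C1 unfolding C1_field_def v_def[abs_def] by blast
  \<comment> \<open>The derivative inherits periodicity because it is unique; being continuous as
    well, it is bounded, and this bound is L.\<close>
  have perD: "D (x + k) = D x" if k: "k \<in> int_vecs" for x k
  proof -
    have "((\<lambda>y. v (y + k)) has_derivative (\<lambda>h. blinfun_apply (D (x + k)) (h + 0))) (at x)"
      by (rule has_derivative_compose[of "\<lambda>y. y + k" _ x UNIV v, OF _ D])
         (intro has_derivative_add has_derivative_ident has_derivative_const)
    then have "(v has_derivative blinfun_apply (D (x + k))) (at x)"
      using per[OF k] by simp
    then have "blinfun_apply (D (x + k)) = blinfun_apply (D x)"
      using D has_derivative_unique by blast
    then show ?thesis by (simp add: blinfun_apply_inject)
  qed
  have contv: "continuous_on UNIV v"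
    using has_derivative_continuous[OF D] continuous_at_imp_continuous_on by blast
  obtain V where V: "\<And>x. norm (v x) \<le> V"
    using bounded_range_periodic[OF contv per] unfolding bounded_iff by blast
  obtain L where L: "\<And>x. norm (D x) \<le> L"
    using bounded_range_periodic[OF contD perD] unfolding bounded_iff by blast
  have D_bound: "norm (blinfun_apply (D x) y) \<le> L * norm y" for x y
    using norm_blinfun[of "D x" y] mult_right_mono[OF L[of x], of "norm y"] by simp
  obtain c where c: "\<And>x t. torus_proj (c x t) = \<Phi> t x"
    "\<And>x t. (c x has_vector_derivative u (\<Phi> t x)) (at t)" and \<Phi>0: "\<Phi> 0 = id"
    using flow unfolding is_flow_def by metis
  define \<phi> where "\<phi> t y = c (torus_proj y) t + (y - c (torus_proj y) 0)" for t y
  have shift: "y - c (torus_proj y) 0 \<in> int_vecs" for y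
    using c(1)[of "torus_proj y" 0] \<Phi>0 by (simp flip: torus_proj_eq_iff)
  have proj: "torus_proj (\<phi> t y) = \<Phi> t (torus_proj y)" for t y
    by (simp add: \<phi>_def torus_proj_plus_int[OF shift] c)
  have "divergence_free_flow v \<phi> L V (\<lambda>x. blinfun_apply (D x))"
  proof
    show "norm (v x - v y) \<le> L * norm (x - y)" for x y
    proof (rule differentiable_bound[of UNIV])
      show "onorm (blinfun_apply (D x)) \<le> L" for x
        using L by (simp add: norm_blinfun.rep_eq)
    qed (use D in auto)
    show "L \<ge> 0"
      using L[of 0] norm_ge_zero order_trans by blast
    show "\<phi> 0 x = x" for x
      by (simp add: \<phi>_def)
    show "((\<lambda>t. \<phi> t x) has_vector_derivative v (\<phi> t x)) (at t)" for x t
      using has_vector_derivative_add[OF c(2)[of "torus_proj x" t] has_vector_derivative_const]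
      unfolding v_def proj by (simp add: \<phi>_def)
    show "(\<Sum>i\<in>UNIV. blinfun_apply (D x) (axis i 1) $ i) = 0" for x
      using div frechet_derivative_at[OF D[of x]]
      by (simp add: divergence_free_def divergence_def v_def[abs_def])
  qed (use D V D_bound in auto)
  with proj show thesis
    by (intro that) (auto simp: v_def[abs_def])
qed

text \<open>The torus carries the quotient topology, so continuity is tested on the cover. For the
  measure, the preimage of a set in the unit cell is pulled back by the lift from the moved cell
  \<open>E\<close>; Lebesgue invariance of the lift removes the flow, and the comparison of
  fundamental domains replaces \<open>E\<close> by the unit cell.\<close>

theorem torus_flow_automorphism:
  assumes "C1_field u" "divergence_free u" "is_flow u \<Phi>" and t: "t \<ge> 0"
  shows "bij (\<Phi> t)" "\<Phi> t \<in> borel_measurable borel" "inv (\<Phi> t) \<in> borel_measurable borel"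
    "distr haar haar (\<Phi> t) = haar"
proof -
  obtain \<phi> L V D where "divergence_free_flow (\<lambda>y. u (torus_proj y)) \<phi> L V D"
    and proj: "\<And>t y. torus_proj (\<phi> t y) = \<Phi> t (torus_proj y)"
    using torus_flow_lift[OF assms(1-3)] by blast
  then interpret divergence_free_flow "\<lambda>y. u (torus_proj y)" \<phi> L V D
    by simp
  have inverse: "\<Phi> (- s) (\<Phi> s x) = x" for s x
    using ex_torus_proj[of x] flow_inverse(1)[of s] by (metis proj)
  show bij: "bij (\<Phi> t)"
    using inverse[of t] inverse[of "- t"] by (metis bijI' minus_minus)
  have inv: "inv (\<Phi> t) = \<Phi> (- t)"
    using inverse[of t] inverse[of "- t"] by (intro inv_equality) auto
  have "continuous_on UNIV (\<Phi> s)" for s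
    unfolding continuous_on_open_vimage[OF open_UNIV]
  proof (intro allI impI)
    fix B :: "torus3 set" assume "open B"
    have "torus_proj -` (\<Phi> s -` B) = \<phi> s -` (torus_proj -` B)"
      by (auto simp: proj)
    moreover have "open (\<phi> s -` (torus_proj -` B))"
      using \<open>open B\<close> continuous_on_flow[of UNIV s]
      by (auto simp: open_torus3_def intro: open_vimage[where f = "\<phi> s"])
    ultimately show "open (\<Phi> s -` B \<inter> UNIV)"
      by (simp add: open_torus3_def)
  qed
  then have meas [measurable]: "\<Phi> s \<in> borel_measurable borel" for s
    by (rule borel_measurable_continuous_onI)
  show "\<Phi> t \<in> borel_measurable borel" "inv (\<Phi> t) \<in> borel_measurable borel"
    by (simp_all add: inv meas)
  have [measurable]: "\<phi> s \<in> borel_measurable borel" for s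
    by (intro borel_measurable_continuous_onI continuous_on_flow)
  \<comment> \<open>An integer translate of a solution solves the same equation, the field being
    periodic, so uniqueness identifies it.\<close>
  have equivariant: "\<phi> s (x + k) = \<phi> s x + k" if k: "k \<in> int_vecs" for s x k
  proof -
    have "((\<lambda>s. \<phi> s x + k) has_vector_derivative u (torus_proj (\<phi> s x + k))) (at s)" for s
      using has_vector_derivative_add[OF flow_deriv[of x s] has_vector_derivative_const[of k]]
      by (simp add: torus_proj_plus_int k)
    from flow_unique[OF this, of s] show ?thesis by (simp add: flow_0)
  qed
  show "distr haar haar (\<Phi> t) = haar"
  proof (rule measure_eqI)
    fix B assume "B \<in> sets (distr haar haar (\<Phi> t))"
    then have [measurable]: "B \<in> sets borel" by simp
    have [measurable]: "torus_proj -` B \<in> sets borel"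
      using measurable_sets[OF torus_proj_measurable, of B] by simp
    note [measurable] = unit_cell_borel
    \<comment> \<open>This is the image of the unit cell under \<phi>_t, written as a preimage so
      that it is visibly a Borel set.\<close>
    define E where "E = \<phi> (- t) -` unit_cell"
    have [measurable]: "E \<in> sets borel"
      using measurable_sets[of "\<phi> (- t)" borel borel unit_cell] by (simp add: E_def unit_cell_borel)
    have tiles: "\<exists>!k. k \<in> int_vecs \<and> x + k \<in> E" for x
      using unit_cell_tiles[of "\<phi> (- t) x"] by (simp add: E_def equivariant cong: conj_cong)
    have "emeasure (distr haar haar (\<Phi> t)) B = emeasure haar (\<Phi> t -` B)"
      by (subst emeasure_distr) (auto simp: measurable_cong_sets[OF sets_haar sets_haar])
    also have "\<dots> = emeasure lborel (unit_cell \<inter> torus_proj -` (\<Phi> t -` B))"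
      using measurable_sets[OF meas, of B t] by (intro emeasure_haar) simp
    also have "unit_cell \<inter> torus_proj -` (\<Phi> t -` B) = \<phi> t -` (E \<inter> torus_proj -` B)"
      by (auto simp: E_def flow_inverse proj)
    also have "emeasure lborel \<dots> = emeasure (distr lborel borel (\<phi> t)) (E \<inter> torus_proj -` B)"
      by (subst emeasure_distr) auto
    also have "\<dots> = emeasure lborel (E \<inter> torus_proj -` B)"
      by (simp add: flow_preserves_lborel t)
    also have "\<dots> = emeasure lborel (unit_cell \<inter> torus_proj -` B)"
      by (rule emeasure_fundamental_domain_eq)
         (auto simp: tiles unit_cell_tiles torus_proj_plus_int)
    also have "\<dots> = emeasure haar B"
      by (simp add: emeasure_haar)
    finally show "emeasure (distr haar haar (\<Phi> t)) B = emeasure haar B" .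
  qed simp
qed

section \<open>Complex inner products and adjoints\<close>

lemma cinner_self: "Im (cinner x x) = 0" "Re (cinner x x) \<ge> 0" for x :: "'h::complex_inner"
  using cinner_commute[of x x] inner_ge_zero[of x]
  by (auto simp: inner_eq_Re_cinner complex_eq_iff)

lemma cinner_ext:
  fixes x y :: "'h::complex_inner"
  assumes "\<And>z. cinner x z = cinner y z"
  shows "x = y"
proof -
  have "inner (x - y) (x - y) = 0"
    unfolding inner_diff_left by (simp add: inner_eq_Re_cinner assms)
  then show ?thesis by simp
qed

text \<open>The inner product separates points, so any operator that satisfies the adjoint identity
  is the one that \<open>adj\<close> describes; adjoints are computed by exhibiting them.\<close>

lemma adj_eqI:
  assumes "\<And>x y. cinner (blinfun_apply B x) y = cinner x (blinfun_apply A y)"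
  shows "adj A = B"
  unfolding adj_def
proof (rule the_equality)
  show "\<forall>x y. cinner (blinfun_apply B x) y = cinner x (blinfun_apply A y)"
    using assms by blast
  fix B' assume "\<forall>x y. cinner (blinfun_apply B' x) y = cinner x (blinfun_apply A y)"
  then show "B' = B"
    by (intro blinfun_eqI cinner_ext) (simp add: assms)
qed

lemma scaleC_op_of_real: "scaleC_op (complex_of_real r) = r *\<^sub>R id_blinfun"
proof -
  have "scaleC_op (complex_of_real r) = Blinfun (\<lambda>x. r *\<^sub>R x)"
    by (simp add: scaleC_op_def scaleC_of_real[abs_def])
  also have "\<dots> = r *\<^sub>R id_blinfun"
    by (rule blinfun_eqI) (simp add: bounded_linear_Blinfun_apply bounded_linear_scaleR_right blinfun.scaleR_left)
  finally show ?thesis .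
qed

section \<open>Multiplication operators\<close>

text \<open>The chosen representatives respect sums, scalars and operators almost everywhere only;
  operator identities are therefore proved by collecting the exceptional null sets and comparing
  representatives outside them.\<close>

lemma L2_eqI: "AE x in haar. rep_L2 g x = rep_L2 h x \<Longrightarrow> g = h"
  using abs_L2_eq_iff[OF sq_integrable_rep_L2 sq_integrable_rep_L2, of g h] by (simp add: abs_rep_L2)

lemma rep_L2_add: "AE x in haar. rep_L2 (g + h) x = rep_L2 g x + rep_L2 h x"
  using rep_abs_L2[OF sq_integrable_add[OF sq_integrable_rep_L2 sq_integrable_rep_L2], of g h]
  by (simp add: abs_rep_L2 sq_integrable_rep_L2 flip: abs_L2_add)

lemma rep_L2_scaleC: "AE x in haar. rep_L2 (scaleC a g) x = a * rep_L2 g x"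
  using rep_abs_L2[OF sq_integrable_cmult[OF sq_integrable_rep_L2], of a g] scaleC_L2.abs_eq[of "rep_L2 g" a]
  by (simp add: abs_rep_L2 sq_integrable_rep_L2)

lemma cinner_L2_rep: "cinner g h = (\<integral>x. cnj (rep_L2 g x) * rep_L2 h x \<partial>haar)"
  using cinner_L2.abs_eq[of "rep_L2 g" "rep_L2 h"] by (simp add: abs_rep_L2 sq_integrable_rep_L2)

lemma measurable_rep_L2 [measurable]: "rep_L2 g \<in> borel_measurable haar"
  using sq_integrable_rep_L2[of g] by (simp add: sq_integrable_def)

lemma rep_mult_op: "f \<in> Linf \<Longrightarrow> AE x in haar. rep_L2 (blinfun_apply (mult_op f) g) x = f x * rep_L2 g x"
  by (simp add: mult_op_apply rep_abs_L2 sq_integrable_mult sq_integrable_rep_L2)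

section \<open>The algebra of essentially bounded functions and its representation\<close>

lemma LinfI: "f \<in> borel_measurable haar \<Longrightarrow> AE x in haar. cmod (f x) \<le> C \<Longrightarrow> f \<in> Linf"
  by (auto simp: Linf_def)

lemma LinfE:
  assumes "f \<in> Linf"
  obtains C where "C \<ge> 0" "AE x in haar. cmod (f x) \<le> C"
proof -
  obtain C where "AE x in haar. cmod (f x) \<le> C"
    using assms by (auto simp: Linf_def)
  then have "AE x in haar. cmod (f x) \<le> \<bar>C\<bar>"
    by eventually_elim simp
  then show thesis by (intro that[of "\<bar>C\<bar>"]) auto
qed

lemma Linf_measurable: "f \<in> Linf \<Longrightarrow> f \<in> borel_measurable haar"
  by (simp add: Linf_def)

lemma Linf_of_real_measurable: "(\<lambda>x. complex_of_real (k x)) \<in> Linf \<Longrightarrow> k \<in> borel_measurable haar"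
  using Linf_measurable[of "\<lambda>x. complex_of_real (k x)"]
    borel_measurable_complex_iff[of "\<lambda>x. complex_of_real (k x)"] by simp

lemma Linf_const: "(\<lambda>x. c) \<in> Linf"
  by (rule LinfI[of _ "cmod c"]) auto

lemma Linf_add:
  assumes "f \<in> Linf" "g \<in> Linf"
  shows "(\<lambda>x. f x + g x) \<in> Linf"
proof -
  obtain C where C: "AE x in haar. cmod (f x) \<le> C"
    using LinfE[OF assms(1)] .
  obtain D where "AE x in haar. cmod (g x) \<le> D"
    using LinfE[OF assms(2)] .
  with C have "AE x in haar. cmod (f x + g x) \<le> C + D"
    by eventually_elim (rule norm_triangle_mono)
  then show ?thesis
    using assms[THEN Linf_measurable] by (intro LinfI) auto
qed

lemma Linf_mult:
  assumes "f \<in> Linf" "g \<in> Linf"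
  shows "(\<lambda>x. f x * g x) \<in> Linf"
proof -
  obtain C where C: "C \<ge> 0" "AE x in haar. cmod (f x) \<le> C"
    using LinfE[OF assms(1)] .
  obtain D where "AE x in haar. cmod (g x) \<le> D"
    using LinfE[OF assms(2)] .
  with C(2) have "AE x in haar. cmod (f x * g x) \<le> C * D"
    by eventually_elim (simp add: C norm_mult mult_mono)
  then show ?thesis
    using assms[THEN Linf_measurable] by (intro LinfI) auto
qed

lemma Linf_diff: "f \<in> Linf \<Longrightarrow> g \<in> Linf \<Longrightarrow> (\<lambda>x. f x - g x) \<in> Linf"
  using Linf_add[of f "\<lambda>x. (-1) * g x"] Linf_mult[OF Linf_const[of "-1"], of g] by simp

lemma Linf_cnj: "f \<in> Linf \<Longrightarrow> (\<lambda>x. cnj (f x)) \<in> Linf"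
  by (auto simp: Linf_def)

lemma Linf_sum: "(\<And>i. i \<in> I \<Longrightarrow> f i \<in> Linf) \<Longrightarrow> (\<lambda>x. \<Sum>i\<in>I. f i x) \<in> Linf"
  by (induction I rule: infinite_finite_induct) (auto intro: Linf_const Linf_add)

lemma Linf_power: "f \<in> Linf \<Longrightarrow> (\<lambda>x. f x ^ n) \<in> Linf"
  by (induction n) (auto intro: Linf_const Linf_mult)

lemma mult_op_compose:
  assumes "f \<in> Linf" "g \<in> Linf"
  shows "blinfun_apply (mult_op f) (blinfun_apply (mult_op g) h) = blinfun_apply (mult_op (\<lambda>x. f x * g x)) h"
    (is "?l = ?r")
proof (rule L2_eqI)
  show "AE x in haar. rep_L2 ?l x = rep_L2 ?r x"
    using rep_mult_op[OF assms(1), of "blinfun_apply (mult_op g) h"] rep_mult_op[OF assms(2), of h]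
      rep_mult_op[OF Linf_mult[OF assms], of h]
    by eventually_elim simp
qed

lemma mult_op_add:
  assumes "f \<in> Linf" "g \<in> Linf"
  shows "mult_op (\<lambda>x. f x + g x) = mult_op f + mult_op g"
proof (intro blinfun_eqI L2_eqI)
  fix h
  show "AE x in haar. rep_L2 (blinfun_apply (mult_op (\<lambda>x. f x + g x)) h) x =
      rep_L2 (blinfun_apply (mult_op f + mult_op g) h) x"
    using rep_mult_op[OF assms(1), of h] rep_mult_op[OF assms(2), of h]
      rep_mult_op[OF Linf_add[OF assms], of h]
      rep_L2_add[of "blinfun_apply (mult_op f) h" "blinfun_apply (mult_op g) h"]
    unfolding blinfun.add_left by eventually_elim (simp add: distrib_right)
qed

lemma mult_op_const: "mult_op (\<lambda>x. complex_of_real r) = r *\<^sub>R id_blinfun"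
proof (intro blinfun_eqI L2_eqI)
  fix h
  show "AE x in haar. rep_L2 (blinfun_apply (mult_op (\<lambda>x. complex_of_real r)) h) x =
      rep_L2 (blinfun_apply (r *\<^sub>R id_blinfun) h) x"
    using rep_mult_op[OF Linf_const, of "complex_of_real r" h] rep_L2_scaleC[of "complex_of_real r" h]
    by eventually_elim (simp add: blinfun.scaleR_left scaleR_L2_def)
qed

lemma mult_op_scaleC:
  assumes "f \<in> Linf"
  shows "blinfun_apply (mult_op f) (scaleC a h) = scaleC a (blinfun_apply (mult_op f) h)"
    (is "?l = ?r")
proof (rule L2_eqI)
  show "AE x in haar. rep_L2 ?l x = rep_L2 ?r x"
    using rep_mult_op[OF assms, of "scaleC a h"] rep_mult_op[OF assms, of h]
      rep_L2_scaleC[of a h] rep_L2_scaleC[of a "blinfun_apply (mult_op f) h"]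
    by eventually_elim simp
qed

lemma mult_op_adjoint:
  assumes f: "f \<in> Linf"
  shows "cinner (blinfun_apply (mult_op (\<lambda>x. cnj (f x))) g) h = cinner g (blinfun_apply (mult_op f) h)"
  unfolding cinner_L2_rep
proof (rule integral_cong_AE)
  show "AE x in haar. cnj (rep_L2 (blinfun_apply (mult_op (\<lambda>x. cnj (f x))) g) x) * rep_L2 h x =
      cnj (rep_L2 g x) * rep_L2 (blinfun_apply (mult_op f) h) x"
    using rep_mult_op[OF f, of h] rep_mult_op[OF Linf_cnj[OF f], of g] by eventually_elim simp
qed measurable

lemma norm_mult_op_le:
  assumes f: "f \<in> Linf" and C: "AE x in haar. cmod (f x) \<le> C" "C \<ge> 0"
  shows "norm (mult_op f) \<le> C"
proof (rule norm_blinfun_bound)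
  fix g
  note sq = sq_integrable_mult[OF f sq_integrable_rep_L2[of g]]
  have "(norm (blinfun_apply (mult_op f) g))\<^sup>2 = (\<integral>x. (cmod (f x * rep_L2 g x))\<^sup>2 \<partial>haar)"
    by (simp add: mult_op_apply f norm_abs_L2 sq)
  also have "\<dots> \<le> (\<integral>x. C\<^sup>2 * (cmod (rep_L2 g x))\<^sup>2 \<partial>haar)"
  proof (rule integral_mono_AE)
    show "integrable haar (\<lambda>x. (cmod (f x * rep_L2 g x))\<^sup>2)"
      "integrable haar (\<lambda>x. C\<^sup>2 * (cmod (rep_L2 g x))\<^sup>2)"
      using sq sq_integrable_rep_L2[of g] unfolding sq_integrable_def by auto
    show "AE x in haar. (cmod (f x * rep_L2 g x))\<^sup>2 \<le> C\<^sup>2 * (cmod (rep_L2 g x))\<^sup>2"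
      using C(1) by eventually_elim
        (auto simp: norm_mult power_mult_distrib intro!: mult_right_mono power_mono)
  qed
  also have "\<dots> = (C * norm g)\<^sup>2"
    using norm_abs_L2[OF sq_integrable_rep_L2[of g]] by (simp add: abs_rep_L2 power_mult_distrib)
  finally show "norm (blinfun_apply (mult_op f) g) \<le> C * norm g"
    by (rule power2_le_imp_le) (use C in simp)
qed fact

section \<open>Amplified operators\<close>

lemma ell2_eqI: "(\<And>n. Rep_ell2 \<xi> n = Rep_ell2 \<eta> n) \<Longrightarrow> \<xi> = \<eta>"
  by (simp add: fun_eq_iff flip: Rep_ell2_inject)

lemma Rep_ell2_scaleC: "Rep_ell2 (scaleC a \<xi>) n = scaleC a (Rep_ell2 \<xi> n)"
  by (simp add: scaleC_ell2.rep_eq)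

lemma norm_amplify_le: "norm (amplify A) \<le> norm (A :: 'h::complex_inner \<Rightarrow>\<^sub>L 'h)"
proof (rule norm_blinfun_bound)
  fix \<xi> :: "'h ell2"
  have s: "(\<lambda>n. (norm (Rep_ell2 \<eta> n))\<^sup>2) summable_on UNIV" for \<eta> :: "'h ell2"
    using Rep_ell2[of \<eta>] by simp
  have "(norm (blinfun_apply (amplify A) \<xi>))\<^sup>2 \<le> (\<Sum>\<^sub>\<infinity>n. (norm A)\<^sup>2 * (norm (Rep_ell2 \<xi> n))\<^sup>2)"
    unfolding norm_ell2
  proof (rule infsum_mono[OF s])
    show "(\<lambda>n. (norm A)\<^sup>2 * (norm (Rep_ell2 \<xi> n))\<^sup>2) summable_on UNIV"
      by (rule summable_on_cmult_right[OF s])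
    show "(norm (Rep_ell2 (blinfun_apply (amplify A) \<xi>) n))\<^sup>2 \<le> (norm A)\<^sup>2 * (norm (Rep_ell2 \<xi> n))\<^sup>2" for n
      using power_mono[OF norm_blinfun[of A "Rep_ell2 \<xi> n"], of 2]
      by (simp add: amplify_apply power_mult_distrib)
  qed
  also have "\<dots> = (norm A * norm \<xi>)\<^sup>2"
    by (simp add: infsum_cmult_right' norm_ell2 power_mult_distrib)
  finally show "norm (blinfun_apply (amplify A) \<xi>) \<le> norm A * norm \<xi>"
    by (rule power2_le_imp_le) simp
qed simp

lemma norm_at_zero: "norm (at_zero g) = norm g"
proof -
  have "(\<Sum>\<^sub>\<infinity>n. (norm (Rep_ell2 (at_zero g) n))\<^sup>2) = (\<Sum>\<^sub>\<infinity>n\<in>{0 :: int}. (norm g)\<^sup>2)"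
    by (rule infsum_cong_neutral) (auto simp: Rep_ell2_at_zero)
  then have "(norm (at_zero g))\<^sup>2 = (norm g)\<^sup>2"
    by (simp add: norm_ell2)
  then show ?thesis
    by (simp add: power2_eq_iff_nonneg)
qed

lemma amplify_at_zero: "blinfun_apply (amplify A) (at_zero g) = at_zero (blinfun_apply A g)"
  by (rule ell2_eqI) (simp add: amplify_apply Rep_ell2_at_zero blinfun.zero_right)

lemma cp_mult_apply: "Rep_ell2 (blinfun_apply (cp_mult f) \<xi>) n = blinfun_apply (mult_op f) (Rep_ell2 \<xi> n)"
  by (simp add: cp_mult_def amplify_apply)

lemma cp_mult_cong:
  assumes "f \<in> Linf" "g \<in> Linf" "AE x in haar. f x = g x"
  shows "cp_mult f = cp_mult g"
  using mult_op_eq_iff[OF assms(1,2)] assms(3) by (simp add: cp_mult_def)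

lemma cp_mult_compose:
  "f \<in> Linf \<Longrightarrow> g \<in> Linf \<Longrightarrow> cp_mult f o\<^sub>L cp_mult g = cp_mult (\<lambda>x. f x * g x)"
  by (intro blinfun_eqI ell2_eqI) (simp add: cp_mult_apply mult_op_compose)

lemma cp_mult_add:
  "f \<in> Linf \<Longrightarrow> g \<in> Linf \<Longrightarrow> cp_mult (\<lambda>x. f x + g x) = cp_mult f + cp_mult g"
  by (intro blinfun_eqI ell2_eqI)
     (simp add: cp_mult_apply mult_op_add blinfun.add_left Rep_ell2_plus)

lemma cp_mult_const: "cp_mult (\<lambda>x. complex_of_real r) = r *\<^sub>R id_blinfun"
  by (intro blinfun_eqI ell2_eqI)
     (simp add: cp_mult_apply mult_op_const blinfun.scaleR_left Rep_ell2_scaleR)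

lemma cp_mult_scaleR: "f \<in> Linf \<Longrightarrow> cp_mult (\<lambda>x. complex_of_real r * f x) = r *\<^sub>R cp_mult f"
  by (intro blinfun_eqI)
     (simp add: Linf_const cp_mult_const blinfun.scaleR_left flip: cp_mult_compose)

lemma cp_mult_diff:
  assumes "f \<in> Linf" "g \<in> Linf"
  shows "cp_mult (\<lambda>x. f x - g x) = cp_mult f - cp_mult g"
  using cp_mult_add[OF Linf_diff[OF assms] assms(2)] by (simp add: algebra_simps)

lemma cp_mult_sum:
  "(\<And>i. i \<in> I \<Longrightarrow> f i \<in> Linf) \<Longrightarrow> cp_mult (\<lambda>x. \<Sum>i\<in>I. f i x) = (\<Sum>i\<in>I. cp_mult (f i))"
  using cp_mult_const[of 0]
  by (induction I rule: infinite_finite_induct) (auto simp: cp_mult_add Linf_sum)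

lemma cp_mult_bounded_ops: "f \<in> Linf \<Longrightarrow> cp_mult f \<in> bounded_ops"
  unfolding bounded_ops_def
  by (auto intro!: ell2_eqI simp: cp_mult_apply Rep_ell2_scaleC mult_op_scaleC)

lemma norm_cp_mult_le:
  "f \<in> Linf \<Longrightarrow> AE x in haar. cmod (f x) \<le> C \<Longrightarrow> C \<ge> 0 \<Longrightarrow> norm (cp_mult f) \<le> C"
  unfolding cp_mult_def using norm_amplify_le norm_mult_op_le order_trans by blast

lemma cp_mult_adjoint:
  "f \<in> Linf \<Longrightarrow> cinner (blinfun_apply (cp_mult (\<lambda>x. cnj (f x))) \<xi>) \<eta> = cinner \<xi> (blinfun_apply (cp_mult f) \<eta>)"
  by (simp add: cinner_ell2.rep_eq cp_mult_apply mult_op_adjoint)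

text \<open>The real square root s of k gives M_k = M_s M_s with M_s symmetric, so the quadratic
  form is the squared norm of M_s applied to the vector.\<close>

lemma positive_cp_mult:
  assumes k: "(\<lambda>x. complex_of_real (k x)) \<in> Linf" and nonneg: "\<And>x. 0 \<le> k x"
  shows "positive_op (cp_mult (\<lambda>x. complex_of_real (k x)))"
  unfolding positive_op_def
proof (intro conjI allI)
  define s where "s x = complex_of_real (sqrt (k x))" for x
  have s: "s \<in> Linf"
  proof -
    obtain C where "AE x in haar. cmod (complex_of_real (k x)) \<le> C"
      using LinfE[OF k] by blast
    then have "AE x in haar. cmod (s x) \<le> sqrt C"
      by eventually_elim (simp add: s_def nonneg)
    moreover have "k \<in> borel_measurable haar"
      using k by (rule Linf_of_real_measurable)
    ultimately show ?thesis
      unfolding s_def by (intro LinfI) auto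
  qed
  have "cp_mult (\<lambda>x. complex_of_real (k x)) = cp_mult s o\<^sub>L cp_mult s"
    by (simp add: cp_mult_compose s) (simp add: s_def nonneg flip: of_real_mult)
  moreover have "(\<lambda>x. cnj (s x)) = s"
    by (simp add: s_def fun_eq_iff)
  ultimately have "cinner \<xi> (blinfun_apply (cp_mult (\<lambda>x. complex_of_real (k x))) \<xi>) =
      cinner (blinfun_apply (cp_mult s) \<xi>) (blinfun_apply (cp_mult s) \<xi>)" for \<xi>
    using cp_mult_adjoint[OF s, of \<xi>] by simp
  then show "Im (cinner \<xi> (blinfun_apply (cp_mult (\<lambda>x. complex_of_real (k x))) \<xi>)) = 0"
    "Re (cinner \<xi> (blinfun_apply (cp_mult (\<lambda>x. complex_of_real (k x))) \<xi>)) \<ge> 0" for \<xi>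
    by (simp_all add: cinner_self)
qed (rule cp_mult_bounded_ops[OF k])

text \<open>\<open>cond_exp\<close> selects a function known only to induce the same multiplication
  operator. It agrees with \<open>f\<close> off a null set, which the integral ignores.\<close>

lemma cp_trace_cp_mult:
  assumes f: "f \<in> Linf"
  shows "cp_trace (cp_mult f) = (\<integral>x. f x \<partial>haar)"
proof -
  have "entry_00 (cp_mult f) = mult_op f"
    by (rule blinfun_eqI) (simp add: entry_00_apply cp_mult_apply Rep_ell2_at_zero)
  then have "cond_exp (cp_mult f) \<in> Linf \<and> mult_op (cond_exp (cp_mult f)) = mult_op f"
    unfolding cond_exp_def using f by (metis (mono_tags, lifting) someI_ex)
  then show ?thesis
    using mult_op_eq_iff[OF _ f] f unfolding cp_trace_def
    by (intro integral_cong_AE) (auto simp: Linf_measurable)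
qed

section \<open>The commutators with the Koopman unitary\<close>

lemma Rep_ell2_minus: "Rep_ell2 (\<xi> - \<eta>) n = Rep_ell2 \<xi> n - Rep_ell2 \<eta> n"
proof -
  have "Rep_ell2 \<xi> n = Rep_ell2 (\<xi> - \<eta>) n + Rep_ell2 \<eta> n"
    by (simp flip: Rep_ell2_plus)
  then show ?thesis by simp
qed

text \<open>For \<open>A = koopman (inv T)\<close> this is the inverse, and hence the adjoint, of
  \<open>cp_unitary T\<close>.\<close>

definition shift_back :: "('h::complex_inner \<Rightarrow>\<^sub>L 'h) \<Rightarrow> ('h ell2 \<Rightarrow>\<^sub>L 'h ell2)"
  where "shift_back A = Blinfun (\<lambda>\<xi>. Abs_ell2 (\<lambda>n. blinfun_apply A (Rep_ell2 \<xi> (n + 1))))"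

lemma shift_back_apply:
  "Rep_ell2 (blinfun_apply (shift_back A) \<xi>) n = blinfun_apply A (Rep_ell2 \<xi> (n + 1))"
proof -
  have "bij (\<lambda>n :: int. n + 1)"
    by (rule bijI') (auto intro: exI[of _ "_ - 1"])
  from Rep_ell2_shift_apply[OF this, of A] show ?thesis
    by (simp add: shift_back_def bounded_linear_Blinfun_apply)
qed

lemma AE_haar_compose:
  assumes "S \<in> borel_measurable borel" "distr haar haar S = haar" "AE x in haar. P x"
  shows "AE x in haar. P (S x)"
proof -
  have "S \<in> measurable haar haar"
    using assms(1) by (simp cong: measurable_cong_sets)
  moreover have "AE x in distr haar haar S. P x"
    using assms(3) by (simp only: assms(2))
  ultimately show ?thesis by (rule AE_distrD)
qed

text \<open>The operators see the flow through its time-1 map, an invertible bimeasurable map that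
  preserves the Haar measure; invariance under the inverse is derived.\<close>

locale haar_automorphism =
  fixes T :: "torus3 \<Rightarrow> torus3"
  assumes bij: "bij T"
    and measurable_T: "T \<in> borel_measurable borel"
    and measurable_inv: "inv T \<in> borel_measurable borel"
    and pres: "distr haar haar T = haar"
begin

lemma T_inv: "T (inv T x) = x" "inv T (T x) = x"
  using bij by (simp_all add: bij_def surj_f_inv_f inv_f_f)

lemma measurable_haar [measurable]: "T \<in> measurable haar haar" "inv T \<in> measurable haar haar"
  using measurable_T measurable_inv by (simp_all cong: measurable_cong_sets)

lemma pres_inv: "distr haar haar (inv T) = haar"
proof -
  have "distr haar haar (inv T) = distr (distr haar haar T) haar (inv T)"
    by (simp only: pres)
  also have "\<dots> = distr haar haar (\<lambda>x. x)"
    by (subst distr_distr) (simp_all add: o_def T_inv measurable_haar)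
  finally show ?thesis by simp
qed

lemma rep_koopman: "AE x in haar. rep_L2 (blinfun_apply (koopman T) g) x = rep_L2 g (inv T x)"
proof -
  have "integrable (distr haar haar (inv T)) (\<lambda>x. (cmod (rep_L2 g x))\<^sup>2)"
    using sq_integrable_rep_L2[of g] by (simp add: pres_inv sq_integrable_def)
  then have "sq_integrable (\<lambda>x. rep_L2 g (inv T x))"
    by (simp add: sq_integrable_def integrable_distr_eq)
  then show ?thesis
    using rep_abs_L2 by (simp add: koopman_apply(1)[OF measurable_inv pres_inv])
qed

lemma cinner_koopman: "cinner (blinfun_apply (koopman T) g) (blinfun_apply (koopman T) h) = cinner g h"
proof -
  have "cinner (blinfun_apply (koopman T) g) (blinfun_apply (koopman T) h) =
      (\<integral>x. cnj (rep_L2 g (inv T x)) * rep_L2 h (inv T x) \<partial>haar)"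
    unfolding cinner_L2_rep
  proof (rule integral_cong_AE)
    show "AE x in haar. cnj (rep_L2 (blinfun_apply (koopman T) g) x) * rep_L2 (blinfun_apply (koopman T) h) x =
        cnj (rep_L2 g (inv T x)) * rep_L2 h (inv T x)"
      using rep_koopman[of g] rep_koopman[of h] by eventually_elim simp
  qed measurable
  also have "\<dots> = (\<integral>x. cnj (rep_L2 g x) * rep_L2 h x \<partial>distr haar haar (inv T))"
    by (subst integral_distr) auto
  finally show ?thesis
    by (simp add: pres_inv cinner_L2_rep)
qed

lemma koopman_scaleC:
  "blinfun_apply (koopman T) (scaleC a g) = scaleC a (blinfun_apply (koopman T) g)" (is "?l = ?r")
proof (rule L2_eqI)
  show "AE x in haar. rep_L2 ?l x = rep_L2 ?r x"
    using rep_koopman[of "scaleC a g"] rep_koopman[of g]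
      rep_L2_scaleC[of a "blinfun_apply (koopman T) g"]
      AE_haar_compose[OF measurable_inv pres_inv rep_L2_scaleC[of a g]]
    by eventually_elim simp
qed

lemma Linf_compose:
  assumes "f \<in> Linf"
  shows "(\<lambda>x. f (T x)) \<in> Linf"
proof -
  obtain C where "AE x in haar. cmod (f x) \<le> C"
    using LinfE[OF assms] .
  from AE_haar_compose[OF measurable_T pres this] show ?thesis
    using Linf_measurable[OF assms] by (intro LinfI) auto
qed

text \<open>The covariance relation, with f o T on the right of U. In this form the commutator has U
  as its left factor, which cancels against the adjoint in the square.\<close>

lemma mult_op_koopman:
  assumes f: "f \<in> Linf"
  shows "blinfun_apply (mult_op f) (blinfun_apply (koopman T) g) =
    blinfun_apply (koopman T) (blinfun_apply (mult_op (\<lambda>x. f (T x))) g)" (is "?l = ?r")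
proof (rule L2_eqI)
  show "AE x in haar. rep_L2 ?l x = rep_L2 ?r x"
    using rep_mult_op[OF f, of "blinfun_apply (koopman T) g"] rep_koopman[of g]
      rep_koopman[of "blinfun_apply (mult_op (\<lambda>x. f (T x))) g"]
      AE_haar_compose[OF measurable_inv pres_inv rep_mult_op[OF Linf_compose[OF f], of g]]
    by eventually_elim (simp add: T_inv)
qed

lemma haar_automorphism_inv: "haar_automorphism (inv T)"
  using bij measurable_T measurable_inv pres_inv
  by unfold_locales (auto simp: inv_inv_eq bij_imp_bij_inv)

lemma koopman_inv_koopman: "blinfun_apply (koopman (inv T)) (blinfun_apply (koopman T) g) = g"
proof (rule L2_eqI)
  show "AE x in haar. rep_L2 (blinfun_apply (koopman (inv T)) (blinfun_apply (koopman T) g)) x = rep_L2 g x"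
    using haar_automorphism.rep_koopman[OF haar_automorphism_inv, of "blinfun_apply (koopman T) g"]
      AE_haar_compose[OF measurable_T pres rep_koopman[of g]]
    by eventually_elim (simp add: inv_inv_eq bij T_inv)
qed

lemma koopman_koopman_inv: "blinfun_apply (koopman T) (blinfun_apply (koopman (inv T)) g) = g"
  using haar_automorphism.koopman_inv_koopman[OF haar_automorphism_inv, of g]
  by (simp add: inv_inv_eq bij)

lemma cp_unitary_apply:
  "Rep_ell2 (blinfun_apply (cp_unitary T) \<xi>) n = blinfun_apply (koopman T) (Rep_ell2 \<xi> (n - 1))"
  by (simp add: cp_unitary_def shift_amplify_apply)

lemma cp_unitary_bounded_ops: "cp_unitary T \<in> bounded_ops"
  unfolding bounded_ops_def
  by (auto intro!: ell2_eqI simp: cp_unitary_apply Rep_ell2_scaleC koopman_scaleC)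

lemma cinner_cp_unitary:
  "cinner (blinfun_apply (cp_unitary T) \<xi>) (blinfun_apply (cp_unitary T) \<eta>) = cinner \<xi> \<eta>"
proof -
  have "bij (\<lambda>n :: int. n - 1)"
    by (rule bijI') (auto intro: exI[of _ "_ + 1"])
  then show ?thesis
    unfolding cinner_ell2.rep_eq cp_unitary_apply cinner_koopman
    by (rule infsum_reindex_bij_betw)
qed

lemma shift_back_cp_unitary:
  "blinfun_apply (shift_back (koopman (inv T))) (blinfun_apply (cp_unitary T) \<xi>) = \<xi>"
  by (intro ell2_eqI)
     (simp add: shift_back_apply cp_unitary_apply koopman_inv_koopman)

text \<open>The backward shift W' is also a right inverse of the isometry W, so applying W to both
  arguments turns the product of W' \<xi> and \<eta> into that of \<xi> and W \<eta>.\<close>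

lemma cp_unitary_adjoint:
  "cinner (blinfun_apply (shift_back (koopman (inv T))) \<xi>) \<eta> = cinner \<xi> (blinfun_apply (cp_unitary T) \<eta>)"
proof -
  have "blinfun_apply (cp_unitary T) (blinfun_apply (shift_back (koopman (inv T))) \<xi>) = \<xi>"
    by (intro ell2_eqI) (simp add: shift_back_apply cp_unitary_apply koopman_koopman_inv)
  then show ?thesis
    using cinner_cp_unitary[of "blinfun_apply (shift_back (koopman (inv T))) \<xi>" \<eta>] by simp
qed

lemma commutator_cp_unitary:
  assumes f: "f \<in> Linf"
  shows "commutator (cp_unitary T) (cp_mult f) = cp_unitary T o\<^sub>L cp_mult (\<lambda>x. f x - f (T x))"
proof (intro blinfun_eqI ell2_eqI)
  fix \<xi> n
  have "blinfun_apply (mult_op f) g - blinfun_apply (mult_op (\<lambda>x. f (T x))) g =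
      blinfun_apply (mult_op (\<lambda>x. f x - f (T x))) g" for g
    using mult_op_add[OF Linf_diff[OF f Linf_compose[OF f]] Linf_compose[OF f]]
    by (simp add: blinfun.add_left)
  then show "Rep_ell2 (blinfun_apply (commutator (cp_unitary T) (cp_mult f)) \<xi>) n =
      Rep_ell2 (blinfun_apply (cp_unitary T o\<^sub>L cp_mult (\<lambda>x. f x - f (T x))) \<xi>) n"
    by (simp add: commutator_def blinfun.diff_left Rep_ell2_minus cp_unitary_apply cp_mult_apply
        mult_op_koopman[OF f] flip: blinfun.diff_right)
qed

lemma commutator_square:
  assumes f: "f \<in> Linf"
  shows "adj (commutator (cp_unitary T) (cp_mult f)) o\<^sub>L commutator (cp_unitary T) (cp_mult f) =
    cp_mult (\<lambda>x. complex_of_real ((cmod (f x - f (T x)))\<^sup>2))"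
proof -
  let ?d = "\<lambda>x. f x - f (T x)" and ?W' = "shift_back (koopman (inv T))"
  have d: "?d \<in> Linf"
    using f by (intro Linf_diff Linf_compose)
  \<comment> \<open>The adjoint of a product reverses the factors; \<open>?W'\<close> stands for the
    adjoint of the unitary.\<close>
  have "adj (commutator (cp_unitary T) (cp_mult f)) = cp_mult (\<lambda>x. cnj (?d x)) o\<^sub>L ?W'"
    by (rule adj_eqI) (simp add: commutator_cp_unitary f cp_mult_adjoint d cp_unitary_adjoint del: complex_cnj_diff)
  then have "adj (commutator (cp_unitary T) (cp_mult f)) o\<^sub>L commutator (cp_unitary T) (cp_mult f) =
      cp_mult (\<lambda>x. cnj (?d x)) o\<^sub>L cp_mult ?d"
    by (intro blinfun_eqI) (simp add: commutator_cp_unitary f shift_back_cp_unitary)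
  also have "\<dots> = cp_mult (\<lambda>x. cnj (?d x) * ?d x)"
    by (rule cp_mult_compose[OF Linf_cnj[OF d] d])
  also have "(\<lambda>x. cnj (?d x) * ?d x) = (\<lambda>x. complex_of_real ((cmod (?d x))\<^sup>2))"
    by (simp add: complex_norm_square mult.commute fun_eq_iff flip: of_real_power)
  finally show ?thesis .
qed

lemma h_fun_Linf:
  assumes "\<And>j. j \<in> {1..m} \<Longrightarrow> f j \<in> Linf"
  shows "(\<lambda>x. complex_of_real (h_fun T f m x)) \<in> Linf"
    and "\<And>j. j \<in> {1..m} \<Longrightarrow> (\<lambda>x. complex_of_real ((cmod (f j x - f j (T x)))\<^sup>2)) \<in> Linf"
proof -
  show *: "(\<lambda>x. complex_of_real ((cmod (f j x - f j (T x)))\<^sup>2)) \<in> Linf" if "j \<in> {1..m}" for j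
  proof -
    have d: "(\<lambda>x. f j x - f j (T x)) \<in> Linf"
      using assms[OF that] by (intro Linf_diff Linf_compose)
    have "(\<lambda>x. cnj (f j x - f j (T x)) * (f j x - f j (T x))) \<in> Linf"
      by (rule Linf_mult[OF Linf_cnj[OF d] d])
    moreover have "(\<lambda>x. cnj (f j x - f j (T x)) * (f j x - f j (T x))) =
        (\<lambda>x. complex_of_real ((cmod (f j x - f j (T x)))\<^sup>2))"
      by (simp add: complex_norm_square mult.commute fun_eq_iff flip: of_real_power)
    ultimately show ?thesis by simp
  qed
  show "(\<lambda>x. complex_of_real (h_fun T f m x)) \<in> Linf"
    using Linf_sum[of "{1..m}" "\<lambda>j x. complex_of_real ((cmod (f j x - f j (T x)))\<^sup>2)"] *
    by (simp add: h_fun_def)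
qed

lemma A_op_eq:
  assumes f: "\<And>j. j \<in> {1..m} \<Longrightarrow> f j \<in> Linf"
  shows "A_op T f m = cp_mult (\<lambda>x. complex_of_real (1 + h_fun T f m x))"
proof -
  have "A_op T f m = id_blinfun + (\<Sum>j=1..m. cp_mult (\<lambda>x. complex_of_real ((cmod (f j x - f j (T x)))\<^sup>2)))"
    unfolding A_op_def by (simp add: commutator_square f)
  also have "\<dots> = cp_mult (\<lambda>x. complex_of_real 1) + cp_mult (\<lambda>x. complex_of_real (h_fun T f m x))"
    using cp_mult_sum[of "{1..m}" "\<lambda>j x. complex_of_real ((cmod (f j x - f j (T x)))\<^sup>2)"]
      h_fun_Linf(2)[of m f] f cp_mult_const[of 1]
    by (simp add: h_fun_def)
  also have "\<dots> = cp_mult (\<lambda>x. complex_of_real (1 + h_fun T f m x))"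
    using cp_mult_add[OF Linf_const h_fun_Linf(1)[of m f], of "complex_of_real 1"] f by simp
  finally show ?thesis .
qed

end

section \<open>Functional calculus of a multiplication operator\<close>

lemma op_power_cp_mult: "f \<in> Linf \<Longrightarrow> op_power (cp_mult f) n = cp_mult (\<lambda>x. f x ^ n)"
  using cp_mult_const[of 1] by (induction n) (simp_all add: cp_mult_compose Linf_power)

text \<open>The map f -> M_f is a unital algebra homomorphism and therefore commutes with
  polynomials.\<close>

lemma op_poly_cp_mult:
  assumes k: "(\<lambda>x. complex_of_real (k x)) \<in> Linf"
  shows "op_poly p (cp_mult (\<lambda>x. complex_of_real (k x))) = cp_mult (\<lambda>x. complex_of_real (poly p (k x)))"
    and "(\<lambda>x. complex_of_real (poly p (k x))) \<in> Linf"
proof -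
  have eq: "(\<lambda>x. complex_of_real (poly p (k x))) =
      (\<lambda>x. \<Sum>i\<le>degree p. complex_of_real (coeff p i) * complex_of_real (k x) ^ i)"
    by (simp add: poly_altdef)
  have Linf: "(\<lambda>x. complex_of_real (coeff p i) * complex_of_real (k x) ^ i) \<in> Linf" for i
    by (intro Linf_mult[OF Linf_const] Linf_power k)
  show "(\<lambda>x. complex_of_real (poly p (k x))) \<in> Linf"
    unfolding eq by (rule Linf_sum) (rule Linf)
  show "op_poly p (cp_mult (\<lambda>x. complex_of_real (k x))) = cp_mult (\<lambda>x. complex_of_real (poly p (k x)))"
    unfolding eq op_poly_def
    by (subst cp_mult_sum) (simp_all add: Linf op_power_cp_mult[OF k] cp_mult_scaleR Linf_power k)
qed

lemma cp_mult_minus_scaleC_op: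
  "f \<in> Linf \<Longrightarrow> cp_mult f - scaleC_op (complex_of_real r) = cp_mult (\<lambda>x. f x - complex_of_real r)"
  by (simp add: scaleC_op_of_real cp_mult_diff Linf_const cp_mult_const)

text \<open>A point r outside [a, b] has positive distance \<open>d\<close> from it, so k - r is
  essentially bounded away from 0 and its reciprocal gives a bounded inverse.\<close>

lemma real_spectrum_cp_mult_subset:
  assumes k: "(\<lambda>x. complex_of_real (k x)) \<in> Linf" and ab: "AE x in haar. k x \<in> {a..b}"
  shows "{r. complex_of_real r \<in> spectrum (cp_mult (\<lambda>x. complex_of_real (k x)))} \<subseteq> {a..b}"
proof (clarify, rule ccontr)
  fix r assume r: "complex_of_real r \<in> spectrum (cp_mult (\<lambda>x. complex_of_real (k x)))" "r \<notin> {a..b}"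
  define d where "d = (if r < a then a - r else r - b)"
  have d: "d > 0" using r by (auto simp: d_def)
  have kr: "AE x in haar. d \<le> \<bar>k x - r\<bar>"
    using ab by eventually_elim (use r in \<open>auto simp: d_def\<close>)
  have meas: "k \<in> borel_measurable haar"
    using k by (rule Linf_of_real_measurable)
  \<comment> \<open>On the null set where k = r the quotient takes the default value 0; the inverse
    identity is required almost everywhere only.\<close>
  define g where "g x = complex_of_real (1 / (k x - r))" for x
  have g: "g \<in> Linf"
  proof (rule LinfI)
    show "AE x in haar. cmod (g x) \<le> 1 / d"
      using kr by eventually_elim
        (use d in \<open>simp add: g_def norm_divide frac_le flip: of_real_diff\<close>)
    show "g \<in> borel_measurable haar"
      unfolding g_def using meas by measurable
  qed
  have kr': "(\<lambda>x. complex_of_real (k x) - complex_of_real r) \<in> Linf"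
    by (intro Linf_diff k Linf_const)
  have "cp_mult (\<lambda>x. g x * (complex_of_real (k x) - complex_of_real r)) = cp_mult (\<lambda>x. complex_of_real 1)"
  proof (rule cp_mult_cong[OF Linf_mult[OF g kr'] Linf_const])
    show "AE x in haar. g x * (complex_of_real (k x) - complex_of_real r) = complex_of_real 1"
      using kr by eventually_elim (use d in \<open>auto simp: g_def simp flip: of_real_diff of_real_mult\<close>)
  qed
  then have "cp_mult g o\<^sub>L (cp_mult (\<lambda>x. complex_of_real (k x)) - scaleC_op (complex_of_real r)) = id_blinfun"
    "(cp_mult (\<lambda>x. complex_of_real (k x)) - scaleC_op (complex_of_real r)) o\<^sub>L cp_mult g = id_blinfun"
    using cp_mult_const[of 1] k g kr'
    by (simp_all add: cp_mult_minus_scaleC_op cp_mult_compose mult.commute)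
  then show False
    using r(1) cp_mult_bounded_ops[OF g] by (auto simp: spectrum_def)
qed

text \<open>A left inverse \<open>B\<close> of \<open>M\<^bsub>k - r\<^esub>\<close> contradicts \<open>\<parallel>M\<^bsub>k - r\<^esub> 1\<^sub>S\<parallel> \<le> \<epsilon> \<parallel>1\<^sub>S\<parallel>\<close> for \<open>\<epsilon> \<parallel>B\<parallel> < 1\<close>
  unless \<open>S = {x. \<bar>k x - r\<bar> < \<epsilon>}\<close> is a null set.\<close>

lemma resolvent_cp_mult_gap:
  assumes k: "(\<lambda>x. complex_of_real (k x)) \<in> Linf"
    and r: "complex_of_real r \<notin> spectrum (cp_mult (\<lambda>x. complex_of_real (k x)))"
  shows "\<exists>\<epsilon>>0. AE x in haar. \<epsilon> \<le> \<bar>k x - r\<bar>"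
proof -
  obtain B where "B o\<^sub>L (cp_mult (\<lambda>x. complex_of_real (k x)) - scaleC_op (complex_of_real r)) = id_blinfun"
    using r by (auto simp: spectrum_def)
  then have B: "B o\<^sub>L cp_mult (\<lambda>x. complex_of_real (k x) - complex_of_real r) = id_blinfun"
    by (simp add: cp_mult_minus_scaleC_op k)
  \<comment> \<open>Adding 1 to the norm keeps the denominator positive and makes
    \<open>norm B * \<epsilon>\<close> strictly less than 1.\<close>
  define \<epsilon> where "\<epsilon> = 1 / (norm B + 1)"
  have \<epsilon>: "\<epsilon> > 0" "norm B * \<epsilon> < 1"
    by (auto simp: \<epsilon>_def add_nonneg_pos)
  have [measurable]: "k \<in> borel_measurable haar"
    using k by (rule Linf_of_real_measurable)
  define q where "q x = complex_of_real (if \<bar>k x - r\<bar> < \<epsilon> then 1 else 0)" for x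
  have q: "q \<in> Linf"
    unfolding q_def by (rule LinfI[where C = 1]) auto
  have kr: "(\<lambda>x. complex_of_real (k x) - complex_of_real r) \<in> Linf"
    by (intro Linf_diff k Linf_const)
  have one: "sq_integrable (\<lambda>x. 1)"
    using finite_measure.integrable_const[of haar "1 :: real"] finite_measureI[of haar]
    by (simp add: sq_integrable_def emeasure_haar_UNIV)
  define g where "g = blinfun_apply (mult_op q) (abs_L2 (\<lambda>x. 1))"
  \<comment> \<open>Since q is an indicator, q^2 = q: a further factor q does not change the result
    on \<open>g\<close>, and it cuts k - r down to modulus at most \<epsilon>.\<close>
  have "blinfun_apply (mult_op (\<lambda>x. complex_of_real (k x) - complex_of_real r)) g =
      blinfun_apply (mult_op (\<lambda>x. (complex_of_real (k x) - complex_of_real r) * q x)) g"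
  proof -
    have "(\<lambda>x. (complex_of_real (k x) - complex_of_real r) * q x * q x) =
        (\<lambda>x. (complex_of_real (k x) - complex_of_real r) * q x)"
      by (auto simp: q_def fun_eq_iff)
    then show ?thesis
      by (simp add: g_def mult_op_compose Linf_mult kr q)
  qed
  then have "norm (blinfun_apply (mult_op (\<lambda>x. complex_of_real (k x) - complex_of_real r)) g) \<le>
      norm (mult_op (\<lambda>x. (complex_of_real (k x) - complex_of_real r) * q x)) * norm g"
    by (simp add: norm_blinfun)
  moreover have "norm (mult_op (\<lambda>x. (complex_of_real (k x) - complex_of_real r) * q x)) \<le> \<epsilon>"
    using \<epsilon>(1) by (intro norm_mult_op_le Linf_mult kr q) (auto simp: q_def norm_mult simp flip: of_real_diff)
  ultimately have le: "norm (blinfun_apply (mult_op (\<lambda>x. complex_of_real (k x) - complex_of_real r)) g) \<le> \<epsilon> * norm g"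
    using mult_right_mono[OF _ norm_ge_zero] order_trans by blast
  \<comment> \<open>\<open>B\<close> acts on sequences and need not respect their entries; the
    isometric embedding at index 0 carries the estimate from L2 to the space of sequences.\<close>
  have "at_zero g = blinfun_apply (B o\<^sub>L cp_mult (\<lambda>x. complex_of_real (k x) - complex_of_real r)) (at_zero g)"
    by (simp add: B)
  also have "\<dots> = blinfun_apply B (at_zero (blinfun_apply (mult_op (\<lambda>x. complex_of_real (k x) - complex_of_real r)) g))"
    by (simp add: cp_mult_def amplify_at_zero)
  finally have "norm (at_zero g) \<le> norm B * norm (at_zero (blinfun_apply (mult_op (\<lambda>x. complex_of_real (k x) - complex_of_real r)) g))"
    by (simp add: norm_blinfun)
  then have "norm g \<le> norm B * norm (blinfun_apply (mult_op (\<lambda>x. complex_of_real (k x) - complex_of_real r)) g)"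
    by (simp only: norm_at_zero)
  also have "\<dots> \<le> norm B * (\<epsilon> * norm g)"
    by (intro mult_left_mono le) auto
  finally have "norm g \<le> norm B * \<epsilon> * norm g"
    by simp
  then have "g = 0"
    using mult_strict_right_mono[OF \<epsilon>(2), of "norm g"] by (cases "g = 0") auto
  then have "AE x in haar. rep_L2 g x = 0"
    using rep_abs_L2[of "\<lambda>x. 0"] by (simp add: sq_integrable_def zero_L2_def)
  \<comment> \<open>\<open>g\<close> is represented by the indicator q, so its vanishing says that S
    is null.\<close>
  then have "AE x in haar. \<epsilon> \<le> \<bar>k x - r\<bar>"
    using rep_mult_op[OF q, of "abs_L2 (\<lambda>x. 1)"] rep_abs_L2[OF one]
    unfolding g_def by eventually_elim (simp add: q_def split: if_splits)
  then show ?thesis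
    using \<epsilon>(1) by blast
qed

text \<open>Each real value outside the spectrum has a neighbourhood with null preimage. There may
  be uncountably many such values, so each is enclosed in an interval with rational endpoints;
  countably many null preimages then have a null union.\<close>

lemma AE_in_spectrum_cp_mult:
  assumes k: "(\<lambda>x. complex_of_real (k x)) \<in> Linf"
  shows "AE x in haar. complex_of_real (k x) \<in> spectrum (cp_mult (\<lambda>x. complex_of_real (k x)))"
proof -
  define null where "null a b \<longleftrightarrow> (AE x in haar. k x \<notin> {of_rat a <..< of_rat b})" for a b :: rat
  have "AE x in haar. \<forall>a b. null a b \<longrightarrow> k x \<notin> {of_rat a <..< of_rat b}"
    unfolding AE_all_countable
  proof (intro allI)
    show "AE x in haar. null a b \<longrightarrow> k x \<notin> {of_rat a <..< of_rat b}" for a b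
      by (cases "null a b") (auto simp: null_def)
  qed
  then show ?thesis
  proof eventually_elim
    case (elim x)
    show ?case
    proof (rule ccontr)
      assume "complex_of_real (k x) \<notin> spectrum (cp_mult (\<lambda>x. complex_of_real (k x)))"
      then obtain \<epsilon> where \<epsilon>: "\<epsilon> > 0" "AE y in haar. \<epsilon> \<le> \<bar>k y - k x\<bar>"
        using resolvent_cp_mult_gap[OF k] by blast
      obtain a where a: "k x - \<epsilon> < of_rat a" "of_rat a < k x"
        using of_rat_dense[of "k x - \<epsilon>" "k x"] \<epsilon> by auto
      obtain b where b: "k x < of_rat b" "of_rat b < k x + \<epsilon>"
        using of_rat_dense[of "k x" "k x + \<epsilon>"] \<epsilon> by auto
      have "null a b"
        unfolding null_def using \<epsilon>(2) by eventually_elim (use a b in auto)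
      then show False
        using elim a b by auto
    qed
  qed
qed

lemma real_polynomial_approximation:
  fixes g :: "real \<Rightarrow> real"
  assumes "continuous_on {a..b} g"
  obtains p where "uniform_limit {a..b} (\<lambda>n. poly (p n)) g sequentially"
proof -
  have "\<exists>p. \<forall>x\<in>{a..b}. \<bar>g x - poly p x\<bar> < inverse (Suc n)" for n
  proof -
    obtain q where q: "real_polynomial_function q" "\<And>x. x \<in> {a..b} \<Longrightarrow> \<bar>g x - q x\<bar> < inverse (Suc n)"
      using Stone_Weierstrass_real_polynomial_function[of "{a..b}" g "inverse (Suc n)"] assms by auto
    obtain c m where "q = (\<lambda>x. \<Sum>i\<le>m. c i * x ^ i)"
      using q(1) real_polynomial_function_iff_sum by blast
    then have "poly (\<Sum>i\<le>m. monom (c i) i) x = q x" for x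
      by (simp add: poly_sum poly_monom)
    with q(2) show ?thesis by metis
  qed
  then obtain p where p: "\<And>n x. x \<in> {a..b} \<Longrightarrow> \<bar>g x - poly (p n) x\<bar> < inverse (Suc n)"
    by metis
  have "uniform_limit {a..b} (\<lambda>n. poly (p n)) g sequentially"
  proof (rule uniform_limitI)
    fix e :: real assume "e > 0"
    then have "\<forall>\<^sub>F n in sequentially. inverse (real (Suc n)) < e"
      using LIMSEQ_inverse_real_of_nat order_tendstoD(2) by blast
    then show "\<forall>\<^sub>F n in sequentially. \<forall>x\<in>{a..b}. dist (poly (p n) x) (g x) < e"
    proof eventually_elim
      case (elim n)
      then show ?case
        using less_trans[OF p elim] by (simp add: dist_real_def abs_minus_commute)
    qed
  qed
  then show thesis by (rule that)
qed

text \<open>The description in \<open>fun_calc\<close> demands convergence along every sequence that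
  approximates g on the spectrum, which holds because k takes almost all its values there. If no
  such sequence existed, every operator would qualify; Weierstrass on [a, b], which contains the
  real spectrum, provides one.\<close>

theorem fun_calc_cp_mult:
  assumes k: "(\<lambda>x. complex_of_real (k x)) \<in> Linf" and ab: "AE x in haar. k x \<in> {a..b}"
    and g: "continuous_on {a..b} g" and gk: "(\<lambda>x. complex_of_real (g (k x))) \<in> Linf"
  shows "fun_calc g (cp_mult (\<lambda>x. complex_of_real (k x))) = cp_mult (\<lambda>x. complex_of_real (g (k x)))"
proof -
  let ?A = "cp_mult (\<lambda>x. complex_of_real (k x))" and ?B = "cp_mult (\<lambda>x. complex_of_real (g (k x)))"
  let ?S = "{r. complex_of_real r \<in> spectrum ?A}"
  have lim: "(\<lambda>n. op_poly (p n) ?A) \<longlonglongrightarrow> ?B" if p: "uniform_limit ?S (\<lambda>n. poly (p n)) g sequentially" for p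
  proof (rule tendstoI)
    fix e :: real assume e: "e > 0"
    \<comment> \<open>Half of e, because the essential supremum bounds the norm by a weak inequality
      only.\<close>
    have "\<forall>\<^sub>F n in sequentially. \<forall>r\<in>?S. dist (poly (p n) r) (g r) < e / 2"
      using p e by (intro uniform_limitD) auto
    then show "\<forall>\<^sub>F n in sequentially. dist (op_poly (p n) ?A) ?B < e"
    proof eventually_elim
      case (elim n)
      have "op_poly (p n) ?A - ?B = cp_mult (\<lambda>x. complex_of_real (poly (p n) (k x)) - complex_of_real (g (k x)))"
        by (simp add: op_poly_cp_mult[OF k] cp_mult_diff gk)
      moreover have "norm \<dots> \<le> e / 2"
      proof (rule norm_cp_mult_le)
        show "AE x in haar. cmod (complex_of_real (poly (p n) (k x)) - complex_of_real (g (k x))) \<le> e / 2"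
          using AE_in_spectrum_cp_mult[OF k]
          by eventually_elim (use elim in \<open>force simp: dist_real_def simp flip: of_real_diff\<close>)
      qed (use e in \<open>auto intro: Linf_diff op_poly_cp_mult[OF k] gk\<close>)
      ultimately show ?case
        using e by (simp add: dist_norm)
    qed
  qed
  obtain p where p: "uniform_limit {a..b} (\<lambda>n. poly (p n)) g sequentially"
    using real_polynomial_approximation[OF g] .
  have p': "uniform_limit ?S (\<lambda>n. poly (p n)) g sequentially"
    using p real_spectrum_cp_mult_subset[OF k ab] by (rule uniform_limit_on_subset)
  show ?thesis
    unfolding fun_calc_def
    by (rule the_equality) (use lim p' LIMSEQ_unique in blast)+
qed

section \<open>The commutator functional of a flow\<close>

lemma Linf_integrable:
  assumes "f \<in> Linf"
  shows "integrable haar f"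
proof -
  interpret finite_measure haar
    by (rule finite_measureI) (simp add: emeasure_haar_UNIV)
  obtain C where "AE x in haar. cmod (f x) \<le> C"
    using LinfE[OF assms] .
  then show ?thesis
    using Linf_measurable[OF assms] by (rule integrable_const_bound)
qed

theorem theorem3p1:
  fixes u :: "torus3 \<Rightarrow> real^3"
    and \<Phi> :: "real \<Rightarrow> torus3 \<Rightarrow> torus3"
    and f :: "nat \<Rightarrow> torus3 \<Rightarrow> complex"
    and m :: nat
  assumes "C1_field u"
    and "divergence_free u"
    and "is_flow u \<Phi>"
    and "\<And>j. j \<in> {1..m} \<Longrightarrow> f j \<in> Linf"
  shows "cp_Linf \<subseteq> crossed_product (\<Phi> 1)
    \<and> A_op (\<Phi> 1) f m \<in> crossed_product (\<Phi> 1)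
    \<and> positive_op (A_op (\<Phi> 1) f m)
    \<and> A_op (\<Phi> 1) f m \<in> cp_Linf
    \<and> (\<lambda>x. complex_of_real (h_fun (\<Phi> 1) f m x)) \<in> Linf
    \<and> A_op (\<Phi> 1) f m = cp_mult (\<lambda>x. complex_of_real (1 + h_fun (\<Phi> 1) f m x))
    \<and> integrable haar (\<lambda>x. ln (1 + h_fun (\<Phi> 1) f m x))
    \<and> S_func (\<Phi> 1) f m = complex_of_real (\<integral>x. ln (1 + h_fun (\<Phi> 1) f m x) \<partial>haar)
    \<and> (\<integral>x. ln (1 + h_fun (\<Phi> 1) f m x) \<partial>haar) \<ge> 0
    \<and> (S_func (\<Phi> 1) f m = 0 \<longleftrightarrow> (\<forall>j\<in>{1..m}. AE x in haar. f j (\<Phi> 1 x) = f j x))"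
proof -
  interpret haar_automorphism "\<Phi> 1"
    using torus_flow_automorphism[OF assms(1-3), of 1] by unfold_locales auto
  define h where "h = h_fun (\<Phi> 1) f m"
  define l where "l x = ln (1 + h x)" for x
  have h_nonneg: "0 \<le> h x" for x
    by (simp add: h_def h_fun_def sum_nonneg)
  have h: "(\<lambda>x. complex_of_real (h x)) \<in> Linf"
    unfolding h_def using assms(4) by (rule h_fun_Linf(1))
  have k: "(\<lambda>x. complex_of_real (1 + h x)) \<in> Linf"
    using Linf_add[OF Linf_const[of 1] h] by simp
  obtain C where "AE x in haar. cmod (complex_of_real (h x)) \<le> C"
    using LinfE[OF h] .
  then have C: "AE x in haar. h x \<le> C"
    by eventually_elim (simp add: h_nonneg)
  have [measurable]: "h \<in> borel_measurable haar"
    using h by (rule Linf_of_real_measurable)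
  have l_nonneg: "0 \<le> l x" for x
    by (simp add: l_def h_nonneg)
  \<comment> \<open>The inequalities 0 \<le> ln (1 + h) \<le> h transfer the essential bound of h to
    its logarithm.\<close>
  have l: "(\<lambda>x. complex_of_real (l x)) \<in> Linf"
  proof (rule LinfI)
    show "AE x in haar. cmod (complex_of_real (l x)) \<le> C"
      using C
    proof eventually_elim
      case (elim x)
      then show ?case
        using ln_add_one_self_le_self[OF h_nonneg[of x]] l_nonneg[of x] by (simp add: l_def)
    qed
    show "(\<lambda>x. complex_of_real (l x)) \<in> borel_measurable haar"
      unfolding l_def by measurable
  qed
  have l_int: "integrable haar l"
    using integrable_Re[OF Linf_integrable[OF l]] by simp
  have A: "A_op (\<Phi> 1) f m = cp_mult (\<lambda>x. complex_of_real (1 + h x))"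
    unfolding h_def using assms(4) by (rule A_op_eq)
  have "fun_calc ln (cp_mult (\<lambda>x. complex_of_real (1 + h x))) = cp_mult (\<lambda>x. complex_of_real (l x))"
    unfolding l_def
  proof (rule fun_calc_cp_mult[OF k])
    \<comment> \<open>The left endpoint 1 comes from h \<ge> 0 and makes ln continuous on the whole
      interval.\<close>
    show "AE x in haar. 1 + h x \<in> {1..1 + C}"
      using C by eventually_elim (simp add: h_nonneg)
    show "continuous_on {1..1 + C} ln"
      by (intro continuous_on_ln continuous_on_id) auto
  qed (use l in \<open>simp add: l_def\<close>)
  then have S: "S_func (\<Phi> 1) f m = complex_of_real (\<integral>x. l x \<partial>haar)"
    by (simp add: S_func_def A cp_trace_cp_mult l)
  \<comment> \<open>Complex-linear generators lie in their bicommutant. Membership of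
    \<open>A_op\<close> in the crossed product then follows from its membership in
    \<open>cp_Linf\<close>.\<close>
  have "insert (cp_unitary (\<Phi> 1)) cp_Linf \<subseteq> bounded_ops"
    using cp_unitary_bounded_ops cp_mult_bounded_ops by (auto simp: cp_Linf_def)
  then have sub: "cp_Linf \<subseteq> crossed_product (\<Phi> 1)"
    using subset_vN_generated unfolding crossed_product_def by blast
  have A_Linf: "A_op (\<Phi> 1) f m \<in> cp_Linf"
    using k by (auto simp: A cp_Linf_def)
  have pos: "positive_op (A_op (\<Phi> 1) f m)"
    unfolding A by (rule positive_cp_mult[OF k]) (simp add: h_nonneg add_nonneg_nonneg)
  have "S_func (\<Phi> 1) f m = 0 \<longleftrightarrow> (AE x in haar. l x = 0)"
    unfolding S using integral_nonneg_eq_0_iff_AE[OF l_int] l_nonneg by simp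
  \<comment> \<open>ln (1 + h) vanishes exactly where every square in h does. The index set is
    finite, so the quantifier over j can afterwards be moved out of the almost-everywhere
    statement.\<close>
  also have "\<dots> \<longleftrightarrow> (AE x in haar. \<forall>j\<in>{1..m}. f j (\<Phi> 1 x) = f j x)"
  proof (rule AE_cong)
    fix x
    have "l x = 0 \<longleftrightarrow> h x = 0"
      using ln_eq_zero_iff[of "1 + h x"] h_nonneg[of x] by (simp add: l_def)
    also have "\<dots> \<longleftrightarrow> (\<forall>j\<in>{1..m}. f j (\<Phi> 1 x) = f j x)"
      by (auto simp: h_def h_fun_def sum_nonneg_eq_0_iff)
    finally show "l x = 0 \<longleftrightarrow> (\<forall>j\<in>{1..m}. f j (\<Phi> 1 x) = f j x)" .
  qed
  also have "\<dots> \<longleftrightarrow> (\<forall>j\<in>{1..m}. AE x in haar. f j (\<Phi> 1 x) = f j x)"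
    by (rule AE_finite_all) simp
  finally have zero: "S_func (\<Phi> 1) f m = 0 \<longleftrightarrow> (\<forall>j\<in>{1..m}. AE x in haar. f j (\<Phi> 1 x) = f j x)" .
  have "(\<integral>x. l x \<partial>haar) \<ge> 0"
    using l_nonneg by (simp add: integral_nonneg_AE)
  then show ?thesis
    using sub A_Linf pos h A l_int S zero unfolding l_def h_def by blast
qed

end
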